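(* The following statements are true: (i) there exists an $\mathbb{L}$-Bernstein set which belongs to $m_0$; (ii) there exists an $\mathbb{M}$-Bernstein set which belongs to $s_0$.
   Context: A tree on $\omega$ is a nonempty set $T\subseteq\omega^{<\omega}$ closed under initial segments; $[T]=\{x\in\omega^\omega:(\forall n)\ x\restriction n\in T\}$ is its body; for $t\in T$, $succ(t)=\{a\in\omega: t^\frown a\in T\}$; $stem(T)$ is the node $\tau\in T$ such that $|succ(\tau)|>1$ and $|succ(s)|=1$ for each $s\subsetneq\tau$. $T$ is a Sacks (perfect) tree, $T\in\mathbb{S}$, if every $s\in T$ has an extension $t\in T$, $s\subseteq t$, with $|succ(t)|\ge 2$; a Miller tree, $T\in\mathbb{M}$, if every $s\in T$ has an extension $t\in T$, $s\subseteq t$, with $|succ(t)|=\aleph_0$; a Laver tree, $T\in\mathbb{L}$, if $|succ(t)|=\aleph_0$ for every $t\in T$ with $t\supseteq stem(T)$. For a family of trees $\mathbb{T}$, a set $B\subseteq\omega^\omega$ is a $\mathbb{T}$-Bernstein set if for every $T\in\mathbb{T}$ we have $B\cap[T]\neq\emptyset$ and $[T]\setminus B\neq\emptyset$. A set $A\subseteq\omega^\omega$ belongs to $t_0$ if for every $P\in\mathbb{T}$ there is $Q\in\mathbb{T}$ with $Q\subseteq P$ and $[Q]\cap A=\emptyset$; $s_0$ and $m_0$ correspond to $\mathbb{T}=\mathbb{S}$ and $\mathbb{T}=\mathbb{M}$. *)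

theory Defs
  imports Main "HOL-Library.Sublist"
begin

text \<open>
  Finite sequences of natural numbers are lists, with \<^const>\<open>prefix\<close> as the extension order;
  points of the Baire space are functions of type \<^typ>\<open>nat \<Rightarrow> nat\<close>.
\<close>

definition is_tree :: "nat list set \<Rightarrow> bool" where
  "is_tree T \<longleftrightarrow> T \<noteq> {} \<and> (\<forall>t\<in>T. \<forall>s. prefix s t \<longrightarrow> s \<in> T)"

definition restr :: "(nat \<Rightarrow> nat) \<Rightarrow> nat \<Rightarrow> nat list" where
  "restr x n = map x [0..<n]"

definition body :: "nat list set \<Rightarrow> (nat \<Rightarrow> nat) set" where
  "body T = {x. \<forall>n. restr x n \<in> T}"

definition succs :: "nat list set \<Rightarrow> nat list \<Rightarrow> nat set" where
  "succs T t = {a. t @ [a] \<in> T}"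

text \<open>
  Since \<^term>\<open>card A = 0\<close> for infinite \<open>A\<close>, having at least two successors is
  expressed by two distinct elements. A set of natural numbers has cardinality aleph-zero
  iff it is infinite.
\<close>

definition splits :: "nat list set \<Rightarrow> nat list \<Rightarrow> bool" where
  "splits T t \<longleftrightarrow> (\<exists>a\<in>succs T t. \<exists>b\<in>succs T t. a \<noteq> b)"

text \<open>
  The stem is unique when it exists, but a tree without splitting nodes has none. Hence it is
  given as a relation.
\<close>

definition is_stem :: "nat list set \<Rightarrow> nat list \<Rightarrow> bool" where
  "is_stem T \<tau> \<longleftrightarrow>
     \<tau> \<in> T \<and> splits T \<tau> \<and> (\<forall>s. strict_prefix s \<tau> \<longrightarrow> card (succs T s) = 1)"

definition Sacks :: "nat list set set" where
  "Sacks = {T. is_tree T \<and> (\<forall>s\<in>T. \<exists>t\<in>T. prefix s t \<and> splits T t)}"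

definition Miller :: "nat list set set" where
  "Miller = {T. is_tree T \<and> (\<forall>s\<in>T. \<exists>t\<in>T. prefix s t \<and> infinite (succs T t))}"

definition Laver :: "nat list set set" where
  "Laver = {T. is_tree T \<and>
     (\<exists>\<tau>. is_stem T \<tau> \<and> (\<forall>t\<in>T. prefix \<tau> t \<longrightarrow> infinite (succs T t)))}"

definition bernstein :: "nat list set set \<Rightarrow> (nat \<Rightarrow> nat) set \<Rightarrow> bool" where
  "bernstein \<T> B \<longleftrightarrow> (\<forall>T\<in>\<T>. B \<inter> body T \<noteq> {} \<and> body T - B \<noteq> {})"

definition tree_null :: "nat list set set \<Rightarrow> (nat \<Rightarrow> nat) set set" where
  "tree_null \<T> = {A. \<forall>P\<in>\<T>. \<exists>Q\<in>\<T>. Q \<subseteq> P \<and> body Q \<inter> A = {}}"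

end

theory Submission
  imports Complex_Main Defs "HOL-Library.Countable_Set"
begin

text \<open>
  Both parts have the same shape: families \<open>\<T> \<subseteq> \<S>\<close> are given, and a
  set \<open>B\<close> is wanted that is null for \<open>\<S>\<close> and meets the body of every
  tree in \<open>\<T>\<close>. That \<open>B\<close> also misses a point of every such body then
  comes for free, since a tree of \<open>\<T>\<close> belongs to \<open>\<S>\<close> and so has a
  subtree whose body avoids \<open>B\<close>.

  The obvious transfinite induction picks a point \<open>x\<^sub>T\<close> in the body of each
  \<open>T\<close>, outside the bodies of the subtrees \<open>Q\<close> reserved so far. It breaks
  down when fewer than continuum many such bodies can cover the body of \<open>T\<close>. The way
  out is to find, before the induction starts, pairwise disjoint pieces
  \<open>R T \<subseteq> body T\<close> of size continuum which every
  \<open>P \<in> \<S>\<close> can be shrunk to nearly avoid: some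
  \<open>Q \<subseteq> P\<close> meets all pieces but one in a countable set. Then a point of
  \<open>R T\<close> outside fewer than continuum many such countable traces always exists, and
  the points so chosen form a Bernstein set that has fewer than continuum many points in the body
  of each \<open>Q\<close>; as \<open>Q\<close> contains continuum many subtrees with disjoint
  bodies, one of them avoids all these points (\<open>bernstein_from_disjoint_pieces\<close>).

  What tells the pieces apart is, first, a rank that comes from a well-ordered family of functions
  of minimal cardinality and, for pieces of equal rank, a label that can be read off their
  branches.

  For Miller against Sacks, take a dominating family \<open>D\<close> of minimal size. Each
  \<open>\<xi> \<in> D\<close> gets a sequence \<open>c \<xi>\<close> and a function
  \<open>envelope\<close> built from it; the rank of \<open>x\<close> is the first
  \<open>\<xi>\<close> whose envelope dominates \<open>x\<close>. Minimality of \<open>D\<close>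
  lets \<open>c \<xi>\<close> escape all earlier envelopes. If \<open>\<xi>\<close> dominates the
  function that bounds the distance to the next infinitely splitting node of a Miller tree
  \<open>M\<close>, then \<open>M\<close> contains a perfect tree of branches of rank
  \<open>\<xi>\<close> that jump past \<open>c \<xi>\<close> at every stage, and the heights of
  the jumps encode any prescribed bits, in particular \<open>M\<close> itself
  (\<open>Miller_coded_subtree\<close>). So the pieces are disjoint perfect bodies. A perfect tree
  \<open>P\<close> either meets all of them in countable sets, or has a perfect subtree inside one
  of them.

  For Laver against Miller, take an unbounded family \<open>U\<close> of minimal size and an
  unbounded scale \<open>g\<close> along it that is increasing for eventual domination; the rank
  of \<open>x\<close> is the first \<open>\<xi>\<close> for which \<open>g \<xi>\<close> is not
  dominated by \<open>x\<close>. A Laver tree has branches of a fixed rank \<open>\<xi>\<close>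
  whose set \<open>{n. x n < g \<xi> n}\<close> is prescribed inside some infinite set
  (\<open>Laver_realizes_low_sets\<close>), so different Laver trees can be given different such
  sets. A Miller tree can be shrunk so that the rank is constant
  (\<open>Miller_constant_rank\<close>), and then further so that
  \<open>x \<mapsto> {n. x n < g \<xi> n}\<close> is constant or injective
  (\<open>Miller_low_constant_or_injective\<close>); it then meets all pieces but one in at most
  one point.
\<close>

unbundle cardinal_syntax

section \<open>Nodes and branches\<close>

definition through :: "nat list \<Rightarrow> (nat \<Rightarrow> nat) \<Rightarrow> bool" where
  "through t x \<longleftrightarrow> (\<forall>i<length t. x i = t ! i)"

lemma length_restr [simp]: "length (restr x n) = n"
  by (simp add: restr_def)

lemma nth_restr [simp]: "i < n \<Longrightarrow> restr x n ! i = x i"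
  by (simp add: restr_def)

lemma through_restr [simp]: "through (restr x n) x"
  by (simp add: through_def)

lemma restr_length_eq: "through t x \<Longrightarrow> restr x (length t) = t"
  by (auto simp: through_def intro: nth_equalityI)

lemma prefix_nth: "prefix s t \<longleftrightarrow> length s \<le> length t \<and> (\<forall>i<length s. s ! i = t ! i)"
proof
  assume "length s \<le> length t \<and> (\<forall>i<length s. s ! i = t ! i)"
  then have "s = take (length s) t" by (intro nth_equalityI) auto
  then show "prefix s t" by (metis take_is_prefix)
qed (auto simp: prefix_def nth_append)

lemma through_prefix: "prefix s t \<Longrightarrow> through t x \<Longrightarrow> through s x"
  by (auto simp: through_def prefix_nth)

lemma through_snoc [simp]: "through (t @ [a]) x \<longleftrightarrow> through t x \<and> x (length t) = a"
  by (auto simp: through_def nth_append less_Suc_eq)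

lemma through_comparable: "through s x \<Longrightarrow> through t x \<Longrightarrow> length s \<le> length t \<Longrightarrow> prefix s t"
  by (auto simp: through_def prefix_nth)

lemma body_through: "x \<in> body T \<Longrightarrow> through t x \<Longrightarrow> t \<in> T"
  by (metis body_def mem_Collect_eq restr_length_eq)

lemma body_mono: "S \<subseteq> T \<Longrightarrow> body S \<subseteq> body T"
  by (auto simp: body_def)

lemma treeD: "is_tree T \<Longrightarrow> t \<in> T \<Longrightarrow> prefix s t \<Longrightarrow> s \<in> T"
  by (auto simp: is_tree_def)

lemma in_bodyI:
  assumes T: "is_tree T" and ex: "\<And>n. \<exists>t\<in>T. n \<le> length t \<and> through t x"
  shows "x \<in> body T"
  unfolding body_def
proof safe
  fix n
  obtain t where t: "t \<in> T" "n \<le> length t" "through t x" using ex by blast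
  then have "prefix (restr x n) t" by (intro through_comparable[of _ x]) auto
  then show "restr x n \<in> T" using T t(1) treeD by blast
qed

definition initial :: "(nat \<Rightarrow> 'a) \<Rightarrow> nat \<Rightarrow> 'a list" where
  "initial y n = map y [0..<n]"

lemma length_initial [simp]: "length (initial y n) = n"
  by (simp add: initial_def)

lemma nth_initial [simp]: "i < n \<Longrightarrow> initial y n ! i = y i"
  by (simp add: initial_def)

lemma initial_0 [simp]: "initial y 0 = []"
  by (simp add: initial_def)

lemma initial_Suc: "initial y (Suc n) = initial y n @ [y n]"
  by (simp add: initial_def)

lemma prefix_initial: "m \<le> n \<Longrightarrow> prefix (initial y m) (initial y n)"
  by (simp add: prefix_nth)

section \<open>Fusion schemes\<close>

text \<open>
  A fusion argument is packaged as a map from finite words to nodes: the children of a word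
  \<open>u\<close> get nodes that leave \<open>\<tau> u\<close> through pairwise different
  successors. Words over \<^typ>\<open>bool\<close> produce perfect trees, words over
  \<^typ>\<open>nat\<close> produce Miller trees.
\<close>

definition scheme :: "('a list \<Rightarrow> nat list) \<Rightarrow> ('a list \<Rightarrow> 'a \<Rightarrow> nat) \<Rightarrow> bool" where
  "scheme \<tau> l \<longleftrightarrow> (\<forall>u. inj (l u)) \<and> (\<forall>u a. prefix (\<tau> u @ [l u a]) (\<tau> (u @ [a])))"

definition downset :: "('a list \<Rightarrow> nat list) \<Rightarrow> 'a list set \<Rightarrow> nat list set" where
  "downset \<tau> V = {s. \<exists>u\<in>V. prefix s (\<tau> u)}"

definition point :: "('a list \<Rightarrow> nat list) \<Rightarrow> (nat \<Rightarrow> 'a) \<Rightarrow> nat \<Rightarrow> nat" where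
  "point \<tau> y n = \<tau> (initial y (Suc n)) ! n"

lemma scheme_step: "scheme \<tau> l \<Longrightarrow> prefix (\<tau> u @ [l u a]) (\<tau> (u @ [a]))"
  by (simp add: scheme_def)

lemma scheme_mono:
  assumes "scheme \<tau> l" "prefix u v" shows "prefix (\<tau> u) (\<tau> v)"
proof -
  obtain w where "v = u @ w" using assms(2) by (auto simp: prefix_def)
  moreover have "prefix (\<tau> u) (\<tau> (u @ w))"
  proof (induction w rule: rev_induct)
    case (snoc a w)
    have "prefix (\<tau> (u @ w)) (\<tau> ((u @ w) @ [a]))"
      using scheme_step[OF assms(1)] append_prefixD by blast
    with snoc show ?case by (metis append.assoc prefix_order.trans)
  qed simp
  ultimately show ?thesis by simp
qed

lemma scheme_extension:
  assumes "scheme \<tau> l" "prefix (u @ [a]) v" shows "prefix (\<tau> u @ [l u a]) (\<tau> v)"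
  using scheme_step[OF assms(1)] scheme_mono[OF assms] by (rule prefix_order.trans)

lemma scheme_length: "scheme \<tau> l \<Longrightarrow> length u \<le> length (\<tau> u)"
proof (induction u rule: rev_induct)
  case (snoc a u)
  then show ?case using prefix_length_le[OF scheme_step[OF snoc.prems, of u a]] by simp
qed simp

lemma scheme_label:
  assumes "scheme \<tau> l" "prefix (\<tau> u @ [l u a]) t" "prefix (\<tau> u @ [l u b]) t"
  shows "a = b"
proof -
  have "t ! length (\<tau> u) = l u a" "t ! length (\<tau> u) = l u b"
    using assms(2,3) by (auto simp: prefix_def nth_append)
  then show ?thesis using assms(1) by (auto simp: scheme_def dest: injD)
qed

text \<open>
  Two incomparable words are sent to nodes that split apart at the image of their common part, so
  they have no common extension; hence nodes below a common node come from comparable words.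
\<close>

lemma scheme_reflects_prefix:
  assumes sch: "scheme \<tau> l" and t: "prefix (\<tau> u) t" "prefix (\<tau> w) t" "length (\<tau> u) < length (\<tau> w)"
  shows "strict_prefix u w"
proof (cases u w rule: prefix_cases)
  case 1 with t show ?thesis by (auto simp: strict_prefix_def)
next
  case 2
  then have "prefix (\<tau> w) (\<tau> u)" using scheme_mono[OF sch] by (auto simp: strict_prefix_def)
  with t(3) show ?thesis using prefix_length_le by fastforce
next
  case 3
  then obtain v b u' c w' where v: "b \<noteq> c" "u = v @ b # u'" "w = v @ c # w'"
    using parallel_decomp by blast
  have "prefix (\<tau> v @ [l v b]) (\<tau> u)" "prefix (\<tau> v @ [l v c]) (\<tau> w)"
    by (rule scheme_extension[OF sch], simp add: v)+
  then have "prefix (\<tau> v @ [l v b]) t" "prefix (\<tau> v @ [l v c]) t"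
    using t prefix_order.trans by blast+
  with v(1) scheme_label[OF sch] show ?thesis by blast
qed

lemma through_point:
  assumes "scheme \<tau> l" shows "through (\<tau> (initial y n)) (point \<tau> y)"
  unfolding through_def
proof safe
  fix i assume i: "i < length (\<tau> (initial y n))"
  have i': "i < length (\<tau> (initial y (Suc i)))"
    using scheme_length[OF assms, of "initial y (Suc i)"] by simp
  have "prefix (\<tau> (initial y n)) (\<tau> (initial y (max n (Suc i))))"
       "prefix (\<tau> (initial y (Suc i))) (\<tau> (initial y (max n (Suc i))))"
    by (auto intro!: scheme_mono[OF assms] prefix_initial)
  with i i' show "point \<tau> y i = \<tau> (initial y n) ! i"
    unfolding point_def by (simp add: prefix_nth)
qed

lemma point_label:
  assumes "scheme \<tau> l"
  shows "point \<tau> y (length (\<tau> (initial y n))) = l (initial y n) (y n)"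
proof -
  have "through (\<tau> (initial y n) @ [l (initial y n) (y n)]) (point \<tau> y)"
    using through_point[OF assms, of y "Suc n"] scheme_step[OF assms, of "initial y n" "y n"]
      through_prefix unfolding initial_Suc by blast
  then show ?thesis by simp
qed

lemma point_unique:
  assumes "scheme \<tau> l" "\<And>n. through (\<tau> (initial y n)) x"
  shows "x = point \<tau> y"
proof
  fix i
  have "i < length (\<tau> (initial y (Suc i)))"
    using scheme_length[OF assms(1), of "initial y (Suc i)"] by simp
  then show "x i = point \<tau> y i" using assms(2)[of "Suc i"] by (simp add: through_def point_def)
qed

lemma point_inj:
  assumes "scheme \<tau> l" "point \<tau> y = point \<tau> y'" shows "y = y'"
proof -
  have "initial y n = initial y' n" for n
  proof (induction n)
    case (Suc n)
    have "l (initial y n) (y n) = l (initial y n) (y' n)"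
      using Suc point_label[OF assms(1), of y n] point_label[OF assms(1), of y' n] assms(2) by simp
    then have "y n = y' n" using assms(1) by (auto simp: scheme_def dest: injD)
    with Suc show ?case by (simp add: initial_Suc)
  qed simp
  then show ?thesis by (metis ext lessI nth_initial)
qed

lemma downset_is_tree: "V \<noteq> {} \<Longrightarrow> is_tree (downset \<tau> V)"
  by (auto simp: is_tree_def downset_def intro: prefix_order.trans)

lemma downset_subset: "is_tree P \<Longrightarrow> (\<And>u. u \<in> V \<Longrightarrow> \<tau> u \<in> P) \<Longrightarrow> downset \<tau> V \<subseteq> P"
  by (auto simp: downset_def dest: treeD)

lemma point_in_downset:
  assumes "scheme \<tau> l" "\<And>n. initial y n \<in> V"
  shows "point \<tau> y \<in> body (downset \<tau> V)"
proof (rule in_bodyI)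
  show "is_tree (downset \<tau> V)" using assms(2) by (intro downset_is_tree) blast
  fix n show "\<exists>t\<in>downset \<tau> V. n \<le> length t \<and> through t (point \<tau> y)"
    using assms through_point[OF assms(1), of y n] scheme_length[OF assms(1), of "initial y n"]
    by (intro bexI[of _ "\<tau> (initial y n)"]) (auto simp: downset_def)
qed

text \<open>
  The labels at a node are injective, so a branch that reaches \<open>\<tau> u\<close> and goes
  on inside the tree determines the next letter by its value at
  \<open>length (\<tau> u)\<close>. This recovers an infinite word even when each node has
  infinitely many successors, where a compactness argument would not be available.
\<close>

lemma downset_branch:
  assumes sch: "scheme \<tau> l" and V: "\<And>u v. v \<in> V \<Longrightarrow> prefix u v \<Longrightarrow> u \<in> V"
    and x: "x \<in> body (downset \<tau> V)"
  shows "\<exists>y. (\<forall>n. initial y n \<in> V) \<and> x = point \<tau> y"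
proof -
  have beyond: "\<exists>w\<in>V. strict_prefix u w \<and> prefix (restr x n) (\<tau> w)"
    if "through (\<tau> u) x" "n > length (\<tau> u)" for u n
  proof -
    obtain w where w: "w \<in> V" "prefix (restr x n) (\<tau> w)" using x by (auto simp: body_def downset_def)
    have "prefix (\<tau> u) (\<tau> w)"
      using w(2) that by (intro prefix_order.trans[OF through_comparable[of _ x] w(2)]) auto
    then have "strict_prefix u w"
      using prefix_length_le[OF w(2)] that by (intro scheme_reflects_prefix[OF sch]) auto
    with w show ?thesis by blast
  qed
  have step: "\<exists>a. u @ [a] \<in> V \<and> through (\<tau> (u @ [a])) x" if u: "through (\<tau> u) x" for u
  proof -
    have *: "\<exists>a. u @ [a] \<in> V \<and> x (length (\<tau> u)) = l u a \<and>
        (length (\<tau> (u @ [a])) \<le> n \<longrightarrow> through (\<tau> (u @ [a])) x)" if "n > length (\<tau> u)" for n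
    proof -
      obtain w where w: "w \<in> V" "strict_prefix u w" "prefix (restr x n) (\<tau> w)"
        using beyond[OF u, of n] \<open>n > length (\<tau> u)\<close> by blast
      then obtain a where a: "prefix (u @ [a]) w"
        by (metis strict_prefixE' append.assoc append_Cons append_Nil prefixI)
      have m: "prefix (\<tau> (u @ [a])) (\<tau> w)" using scheme_mono[OF sch a] .
      then have "prefix (\<tau> u @ [l u a]) (\<tau> w)" using scheme_step[OF sch] prefix_order.trans by blast
      with w(3) that have "x (length (\<tau> u)) = l u a"
        by (auto simp: prefix_nth nth_append)
      moreover have "through (\<tau> (u @ [a])) x" if "length (\<tau> (u @ [a])) \<le> n"
        using that m w(3) by (auto simp: through_def prefix_nth)
      ultimately show ?thesis using V[OF w(1) a] by blast
    qed
    obtain a where a: "u @ [a] \<in> V" "x (length (\<tau> u)) = l u a" using *[of "Suc (length (\<tau> u))"] by auto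
    obtain b where b: "x (length (\<tau> u)) = l u b"
      "length (\<tau> (u @ [b])) \<le> length (\<tau> u) + length (\<tau> (u @ [a])) + 1 \<longrightarrow> through (\<tau> (u @ [b])) x"
      using *[of "length (\<tau> u) + length (\<tau> (u @ [a])) + 1"] by auto
    have "a = b" using a(2) b(1) sch by (auto simp: scheme_def dest: injD)
    with a b show ?thesis by auto
  qed
  have base: "through (\<tau> []) x" "[] \<in> V"
  proof -
    obtain w where "w \<in> V" "prefix (restr x (length (\<tau> []))) (\<tau> w)"
      using x by (auto simp: body_def downset_def)
    moreover have "prefix (\<tau> []) (\<tau> w)" using scheme_mono[OF sch] by simp
    ultimately show "through (\<tau> []) x" "[] \<in> V" using V[of w "[]"]
      by (auto simp: through_def prefix_nth)
  qed
  have "\<exists>f. \<forall>n. (f n \<in> V \<and> through (\<tau> (f n)) x \<and> length (f n) = n) \<and> (\<exists>a. f (Suc n) = f n @ [a])"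
  proof (rule dependent_nat_choice)
    fix u n assume u: "u \<in> V \<and> through (\<tau> u) x \<and> length u = n"
    then obtain a where "u @ [a] \<in> V" "through (\<tau> (u @ [a])) x" using step by blast
    with u show "\<exists>w. (w \<in> V \<and> through (\<tau> w) x \<and> length w = Suc n) \<and> (\<exists>a. w = u @ [a])"
      by (intro exI[of _ "u @ [a]"]) auto
  qed (use base in auto)
  then obtain f where f: "\<And>n. f n \<in> V \<and> through (\<tau> (f n)) x \<and> length (f n) = n"
    "\<And>n. \<exists>a. f (Suc n) = f n @ [a]" by blast
  define y where "y n = last (f (Suc n))" for n
  have ini: "initial y n = f n" for n
  proof (induction n)
    case 0 then show ?case using f(1)[of 0] by simp
  next
    case (Suc n)
    then show ?case using f(2)[of n] by (auto simp: initial_Suc y_def)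
  qed
  show ?thesis
    by (intro exI[of _ y]) (use f ini point_unique[OF sch] in auto)
qed

text \<open>
  Recursion on the reversed word, because the node of a word depends on the node of its initial
  part.
\<close>

primrec unfold_rev :: "(nat \<Rightarrow> 's \<Rightarrow> 'a \<Rightarrow> 's) \<Rightarrow> 's \<Rightarrow> 'a list \<Rightarrow> 's" where
  "unfold_rev S t [] = t"
| "unfold_rev S t (a # u) = S (length u) (unfold_rev S t u) a"

text \<open>
  Fusion from a one-step extension property: \<open>N k t\<close> says that \<open>t\<close> is
  admissible at depth \<open>k\<close>, and \<open>E\<close> records whatever the step guarantees
  about the labels and the nodes that are chosen.
\<close>

lemma scheme_exists:
  fixes N :: "nat \<Rightarrow> nat list \<Rightarrow> bool" and E :: "nat \<Rightarrow> nat list \<Rightarrow> ('a \<Rightarrow> nat) \<Rightarrow> ('a \<Rightarrow> nat list) \<Rightarrow> bool"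
  assumes base: "N 0 t0"
    and step: "\<And>k t. N k t \<Longrightarrow>
      \<exists>l s. inj l \<and> (\<forall>a. N (Suc k) (s a) \<and> prefix (t @ [l a]) (s a)) \<and> E k t l s"
  shows "\<exists>\<tau> l. scheme \<tau> l \<and> \<tau> [] = t0 \<and> (\<forall>u. N (length u) (\<tau> u)) \<and>
    (\<forall>u. E (length u) (\<tau> u) (l u) (\<lambda>a. \<tau> (u @ [a])))"
proof -
  obtain L S where LS: "\<And>k t. N k t \<Longrightarrow> inj (L k t)"
    "\<And>k t a. N k t \<Longrightarrow> N (Suc k) (S k t a) \<and> prefix (t @ [L k t a]) (S k t a)"
    "\<And>k t. N k t \<Longrightarrow> E k t (L k t) (S k t)"
    using step by metis
  define \<tau> where "\<tau> u = unfold_rev S t0 (rev u)" for u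
  define l where "l u = L (length u) (\<tau> u)" for u
  have [simp]: "\<tau> [] = t0" "\<tau> (u @ [a]) = S (length u) (\<tau> u) a" for u a
    by (simp_all add: \<tau>_def)
  have N: "N (length u) (\<tau> u)" for u
    by (induction u rule: rev_induct) (use base LS(2) in auto)
  show ?thesis
  proof (intro exI[of _ \<tau>] exI[of _ l] conjI allI)
    show "scheme \<tau> l" using N LS by (auto simp: scheme_def l_def)
  next
    fix u show "E (length u) (\<tau> u) (l u) (\<lambda>a. \<tau> (u @ [a]))"
      using LS(3)[OF N[of u]] by (simp add: l_def)
  qed (use N in auto)
qed

section \<open>Perfect and superperfect trees\<close>

definition inf_split :: "nat list set \<Rightarrow> nat list \<Rightarrow> bool" where
  "inf_split T t \<longleftrightarrow> t \<in> T \<and> infinite (succs T t)"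

lemma MillerD:
  assumes "T \<in> Miller" shows "is_tree T" "s \<in> T \<Longrightarrow> \<exists>t. prefix s t \<and> inf_split T t" "\<exists>t. inf_split T t"
  using assms by (auto simp: Miller_def inf_split_def) (auto simp: is_tree_def)

lemma infinite_imp_splits: "infinite (succs T t) \<Longrightarrow> splits T t"
  unfolding splits_def by (metis finite.simps finite_subset insertCI subsetI)

lemma Miller_subset_Sacks: "Miller \<subseteq> Sacks"
  unfolding Miller_def Sacks_def using infinite_imp_splits by blast

lemma Laver_subset_Miller: "Laver \<subseteq> Miller"
proof
  fix T assume "T \<in> Laver"
  then obtain \<tau> where T: "is_tree T" and st: "is_stem T \<tau>"
    and inf: "\<And>t. t \<in> T \<Longrightarrow> prefix \<tau> t \<Longrightarrow> infinite (succs T t)"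
    by (auto simp: Laver_def)
  \<comment> \<open>A node that branches off below the stem would give some node below the stem
  two successors.\<close>
  have "prefix s \<tau> \<or> prefix \<tau> s" if s: "s \<in> T" for s
  proof (rule ccontr)
    assume "\<not> ?thesis"
    then obtain p a s' b t' where p: "a \<noteq> b" "s = p @ a # s'" "\<tau> = p @ b # t'"
      using parallel_decomp[of s \<tau>] by (auto simp: parallel_def)
    have \<tau>T: "\<tau> \<in> T" using st by (simp add: is_stem_def)
    have "a \<in> succs T p" "b \<in> succs T p"
      using p treeD[OF T s, of "p @ [a]"] treeD[OF T \<tau>T, of "p @ [b]"]
      by (auto simp: succs_def prefix_def)
    moreover have "card (succs T p) = 1"
      using st p by (auto simp: is_stem_def strict_prefix_def)
    ultimately show False using p(1) by (auto simp: card_1_singleton_iff)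
  qed
  then show "T \<in> Miller"
    using T inf st by (force simp: Miller_def is_stem_def)
qed

lemma downset_in_Sacks:
  assumes sch: "scheme \<tau> l" and "V \<noteq> {}"
    and "\<And>u. u \<in> V \<Longrightarrow> \<exists>v a b. prefix u v \<and> a \<noteq> b \<and> v @ [a] \<in> V \<and> v @ [b] \<in> V"
  shows "downset \<tau> V \<in> Sacks"
  unfolding Sacks_def
proof safe
  fix s assume "s \<in> downset \<tau> V"
  then obtain u where u: "u \<in> V" "prefix s (\<tau> u)" by (auto simp: downset_def)
  then obtain v a b where v: "prefix u v" "a \<noteq> b" "v @ [a] \<in> V" "v @ [b] \<in> V" using assms(3) by blast
  have *: "\<tau> v @ [l v c] \<in> downset \<tau> V" if "v @ [c] \<in> V" for c
    using that scheme_step[OF sch] by (auto simp: downset_def)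
  show "\<exists>t\<in>downset \<tau> V. prefix s t \<and> splits (downset \<tau> V) t"
  proof (intro bexI conjI)
    show "prefix s (\<tau> v)" using u(2) scheme_mono[OF sch v(1)] prefix_order.trans by blast
    show "splits (downset \<tau> V) (\<tau> v)" unfolding splits_def succs_def
      using *[OF v(3)] *[OF v(4)] v(2) sch by (auto simp: scheme_def dest: injD)
    show "\<tau> v \<in> downset \<tau> V"
      using *[OF v(3)] treeD[OF downset_is_tree[OF assms(2)]] by (metis prefixI)
  qed
qed (use assms downset_is_tree in auto)

lemma downset_in_Miller:
  assumes sch: "scheme \<tau> l" and "V \<noteq> {}"
    and "\<And>u. u \<in> V \<Longrightarrow> \<exists>v\<in>V. prefix u v \<and> infinite {a. v @ [a] \<in> V}"
  shows "downset \<tau> V \<in> Miller"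
  unfolding Miller_def
proof safe
  fix s assume "s \<in> downset \<tau> V"
  then obtain u where u: "u \<in> V" "prefix s (\<tau> u)" by (auto simp: downset_def)
  then obtain v where v: "v \<in> V" "prefix u v" "infinite {a. v @ [a] \<in> V}" using assms(3) by blast
  have "l v ` {a. v @ [a] \<in> V} \<subseteq> succs (downset \<tau> V) (\<tau> v)"
    using scheme_step[OF sch] by (auto simp: downset_def succs_def)
  moreover have "infinite (l v ` {a. v @ [a] \<in> V})"
    using v(3) sch unfolding scheme_def by (meson finite_imageD inj_on_subset subset_UNIV)
  ultimately have "infinite (succs (downset \<tau> V) (\<tau> v))" using finite_subset by blast
  then show "\<exists>t\<in>downset \<tau> V. prefix s t \<and> infinite (succs (downset \<tau> V) t)"
    using v u scheme_mono[OF sch v(2)] prefix_order.trans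
    by (intro bexI[of _ "\<tau> v"]) (auto simp: downset_def)
qed (use assms downset_is_tree in auto)

lemma full_downset_Miller: "scheme \<tau> l \<Longrightarrow> downset \<tau> (UNIV :: nat list set) \<in> Miller"
  by (rule downset_in_Miller) auto

lemma Sacks_scheme:
  assumes P: "P \<in> Sacks"
  obtains \<tau> l where "scheme \<tau> (l :: bool list \<Rightarrow> bool \<Rightarrow> nat)" "\<And>u. \<tau> u \<in> P"
proof -
  have T: "is_tree P" and ext: "\<And>s. s \<in> P \<Longrightarrow> \<exists>t\<in>P. prefix s t \<and> splits P t"
    using P by (auto simp: Sacks_def)
  obtain t0 where t0: "t0 \<in> P" "splits P t0" using T ext unfolding is_tree_def by blast
  have "\<exists>\<tau> l. scheme \<tau> (l :: bool list \<Rightarrow> bool \<Rightarrow> nat) \<and> \<tau> [] = t0 \<and> (\<forall>u. \<tau> u \<in> P \<and> splits P (\<tau> u)) \<and>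
      (\<forall>u :: bool list. True)"
  proof (rule scheme_exists)
    fix t assume t: "t \<in> P \<and> splits P t"
    then obtain a b where ab: "t @ [a] \<in> P" "t @ [b] \<in> P" "a \<noteq> b" by (auto simp: splits_def succs_def)
    then obtain ta tb where "ta \<in> P" "prefix (t @ [a]) ta" "splits P ta"
      "tb \<in> P" "prefix (t @ [b]) tb" "splits P tb" using ext by meson
    then show "\<exists>l s. inj l \<and> (\<forall>c::bool. (s c \<in> P \<and> splits P (s c)) \<and> prefix (t @ [l c]) (s c)) \<and> True"
      using ab(3)
      by (intro exI[of _ "\<lambda>c::bool. if c then a else b"] exI[of _ "\<lambda>c. if c then ta else tb"])
        (auto simp: inj_def)
  qed (use t0 in auto)
  then show ?thesis using that by blast
qed

lemma Sacks_body_nonempty: "P \<in> Sacks \<Longrightarrow> body P \<noteq> {}"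
proof -
  assume P: "P \<in> Sacks"
  obtain \<tau> l where sch: "scheme \<tau> (l :: bool list \<Rightarrow> bool \<Rightarrow> nat)" and in_P: "\<And>u. \<tau> u \<in> P"
    using Sacks_scheme[OF P] by blast
  have "point \<tau> (\<lambda>_. True) \<in> body (downset \<tau> UNIV)" using point_in_downset[OF sch] by blast
  moreover have "downset \<tau> UNIV \<subseteq> P" using P in_P by (intro downset_subset) (auto simp: Sacks_def)
  ultimately show ?thesis using body_mono by blast
qed

lemma Miller_scheme:
  assumes P: "P \<in> Miller"
  obtains \<tau> l where "scheme \<tau> (l :: nat list \<Rightarrow> nat \<Rightarrow> nat)" "\<And>u. \<tau> u \<in> P"
proof -
  obtain t0 where t0: "inf_split P t0" using MillerD[OF P] by blast
  have "\<exists>\<tau> l. scheme \<tau> (l :: nat list \<Rightarrow> nat \<Rightarrow> nat) \<and> \<tau> [] = t0 \<and> (\<forall>u. inf_split P (\<tau> u)) \<and>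
      (\<forall>u :: nat list. True)"
  proof (rule scheme_exists)
    fix t assume t: "inf_split P t"
    then obtain l :: "nat \<Rightarrow> nat" where l: "inj l" "range l \<subseteq> succs P t"
      using infinite_countable_subset unfolding inf_split_def by blast
    then have "\<forall>a. \<exists>s. inf_split P s \<and> prefix (t @ [l a]) s"
      using MillerD(2)[OF P] by (auto simp: succs_def image_subset_iff)
    with l(1) show "\<exists>l s. inj l \<and> (\<forall>c::nat. inf_split P (s c) \<and> prefix (t @ [l c]) (s c)) \<and> True"
      by metis
  qed (use t0 in auto)
  then show ?thesis using that by (auto simp: inf_split_def)
qed

text \<open>
  This is how a tree avoids fewer than continuum many points.
\<close>

definition splittable :: "nat list set set \<Rightarrow> bool" where
  "splittable \<T> \<longleftrightarrow> (\<forall>P\<in>\<T>. \<exists>Q :: (nat \<Rightarrow> bool) \<Rightarrow> nat list set.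
     (\<forall>y. Q y \<in> \<T> \<and> Q y \<subseteq> P) \<and> (\<forall>y z. y \<noteq> z \<longrightarrow> body (Q y) \<inter> body (Q z) = {}))"

text \<open>
  Prescribing letters at the positions in \<open>E\<close> leaves a perfect tree as long as
  infinitely many positions stay free.
\<close>

lemma constrained_downset_Sacks:
  fixes \<tau> :: "bool list \<Rightarrow> nat list"
  assumes sch: "scheme \<tau> l" and free: "\<And>n. \<exists>k\<ge>n. k \<notin> E"
  shows "downset \<tau> {u. \<forall>k<length u. k \<in> E \<longrightarrow> u ! k = y k} \<in> Sacks" (is "downset \<tau> ?V \<in> Sacks")
proof (rule downset_in_Sacks[OF sch])
  have "[] \<in> ?V" by simp
  then show "?V \<noteq> {}" by blast
next
  fix u assume u: "u \<in> ?V"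
  obtain k where k: "k \<ge> length u" "k \<notin> E" using free by blast
  define v where "v = u @ map y [length u..<k]"
  have "v @ [b] \<in> ?V" for b
    using u k by (auto simp: v_def nth_append less_Suc_eq)
  moreover have "prefix u v" by (simp add: v_def)
  ultimately show "\<exists>v a b. prefix u v \<and> a \<noteq> b \<and> v @ [a] \<in> ?V \<and> v @ [b] \<in> ?V"
    by (intro exI[of _ v] exI[of _ True] exI[of _ False] conjI) (simp_all del: mem_Collect_eq)
qed

lemma splittable_Sacks: "splittable Sacks"
  unfolding splittable_def
proof
  fix P assume P: "P \<in> Sacks"
  obtain \<tau> l where sch: "scheme \<tau> (l :: bool list \<Rightarrow> bool \<Rightarrow> nat)" and in_P: "\<And>u. \<tau> u \<in> P"
    using Sacks_scheme[OF P] by blast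
  \<comment> \<open>The even letters spell \<open>y\<close>, which makes the bodies disjoint; the
  odd letters keep the tree perfect.\<close>
  define V where "V y = {u. \<forall>k<length u. k \<in> {k. even k} \<longrightarrow> u ! k = (y (k div 2) :: bool)}" for y
  have sub: "downset \<tau> (V y) \<subseteq> P" for y
    using P in_P by (intro downset_subset) (auto simp: Sacks_def)
  have "\<exists>k\<ge>n. k \<notin> {k. even k}" for n :: nat by (intro exI[of _ "2 * n + 1"]) simp
  then have Sacks: "downset \<tau> (V y) \<in> Sacks" for y
    unfolding V_def by (rule constrained_downset_Sacks[OF sch])
  have "y = z" if x: "x \<in> body (downset \<tau> (V y))" "x \<in> body (downset \<tau> (V z))" for x y z
  proof -
    have branch: "\<exists>p. (\<forall>n. initial p n \<in> V w) \<and> x = point \<tau> p" if "x \<in> body (downset \<tau> (V w))" for w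
      by (rule downset_branch[OF sch _ that]) (auto simp: V_def prefix_nth)
    obtain p where p: "\<And>n. initial p n \<in> V y" "x = point \<tau> p"
      using branch[OF x(1)] by blast
    obtain q where q: "\<And>n. initial q n \<in> V z" "x = point \<tau> q"
      using branch[OF x(2)] by blast
    have "p = q" using p q point_inj[OF sch] by blast
    then have "y i = z i" for i
      using p(1)[of "Suc (2 * i)"] q(1)[of "Suc (2 * i)"] by (auto simp: V_def)
    then show "y = z" by blast
  qed
  then have "body (downset \<tau> (V y)) \<inter> body (downset \<tau> (V z)) = {}" if "y \<noteq> z" for y z
    using that by (metis disjoint_iff)
  then show "\<exists>Q :: (nat \<Rightarrow> bool) \<Rightarrow> nat list set. (\<forall>y. Q y \<in> Sacks \<and> Q y \<subseteq> P) \<and>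
      (\<forall>y z. y \<noteq> z \<longrightarrow> body (Q y) \<inter> body (Q z) = {})"
    using sub Sacks by (intro exI[of _ "\<lambda>y. downset \<tau> (V y)"]) simp
qed

lemma splittable_Miller: "splittable Miller"
  unfolding splittable_def
proof
  fix P assume P: "P \<in> Miller"
  obtain \<tau> l where sch: "scheme \<tau> (l :: nat list \<Rightarrow> nat \<Rightarrow> nat)" and in_P: "\<And>u. \<tau> u \<in> P"
    using Miller_scheme[OF P] by blast
  \<comment> \<open>The parities of the letters spell \<open>y\<close>, and each parity class
  leaves infinitely many letters.\<close>
  define V where "V y = {u :: nat list. \<forall>i < length u. even (u ! i) = y i}" for y
  have sub: "downset \<tau> (V y) \<subseteq> P" for y
    using P in_P by (intro downset_subset MillerD)
  have Miller: "downset \<tau> (V y) \<in> Miller" for y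
  proof (rule downset_in_Miller[OF sch])
    show "V y \<noteq> {}" by (auto simp: V_def intro: exI[of _ "[]"])
  next
    fix u assume u: "u \<in> V y"
    have "range (\<lambda>k. 2 * k + of_bool (\<not> y (length u))) \<subseteq> {a. u @ [a] \<in> V y}"
      using u by (auto simp: V_def nth_append less_Suc_eq)
    moreover have "infinite (range (\<lambda>k::nat. 2 * k + of_bool (\<not> y (length u))))"
      by (auto simp: finite_image_iff inj_def)
    ultimately show "\<exists>v\<in>V y. prefix u v \<and> infinite {a. v @ [a] \<in> V y}"
      using u finite_subset by blast
  qed
  have "y = z" if x: "x \<in> body (downset \<tau> (V y))" "x \<in> body (downset \<tau> (V z))" for x y z
  proof -
    have branch: "\<exists>p. (\<forall>n. initial p n \<in> V w) \<and> x = point \<tau> p" if "x \<in> body (downset \<tau> (V w))" for w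
      by (rule downset_branch[OF sch _ that]) (auto simp: V_def prefix_nth)
    obtain p where p: "\<And>n. initial p n \<in> V y" "x = point \<tau> p"
      using branch[OF x(1)] by blast
    obtain q where q: "\<And>n. initial q n \<in> V z" "x = point \<tau> q"
      using branch[OF x(2)] by blast
    have "p = q" using p q point_inj[OF sch] by blast
    then have "y i = z i" for i
      using p(1)[of "Suc i"] q(1)[of "Suc i"] by (auto simp: V_def)
    then show "y = z" by blast
  qed
  then have "body (downset \<tau> (V y)) \<inter> body (downset \<tau> (V z)) = {}" if "y \<noteq> z" for y z
    using that by (metis disjoint_iff)
  then show "\<exists>Q :: (nat \<Rightarrow> bool) \<Rightarrow> nat list set. (\<forall>y. Q y \<in> Miller \<and> Q y \<subseteq> P) \<and> (\<forall>y z. y \<noteq> z \<longrightarrow> body (Q y) \<inter> body (Q z) = {})"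
    using sub Miller by (intro exI[of _ "\<lambda>y. downset \<tau> (V y)"]) simp
qed

text \<open>
  The Cantor-Bendixson argument in one step: keep the nodes through which uncountably many
  branches pass. If no node above \<open>s\<close> splits in this tree, then the branches through
  \<open>s\<close> are at most one branch that stays inside and the countably many countable sets
  of branches that leave it.
\<close>

lemma perfect_set_property:
  assumes T: "is_tree T" and unc: "uncountable (body T)"
  obtains Q where "Q \<in> Sacks" "Q \<subseteq> T"
proof -
  define B where "B t = {x \<in> body T. through t x}" for t
  define Q where "Q = {t. uncountable (B t)}"
  have B_mono: "B t \<subseteq> B s" if "prefix s t" for s t
    using that through_prefix by (auto simp: B_def)
  have sub: "Q \<subseteq> T"
  proof
    fix t assume "t \<in> Q"
    then obtain x where "x \<in> B t" unfolding Q_def by fastforce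
    then show "t \<in> T" using body_through by (auto simp: B_def)
  qed
  have tree: "is_tree Q" unfolding is_tree_def
  proof safe
    have "B [] = body T" by (auto simp: B_def through_def)
    then show "Q = {} \<Longrightarrow> False" using unc unfolding Q_def by (metis empty_iff mem_Collect_eq)
    show "s \<in> Q" if "t \<in> Q" "prefix s t" for s t
      using that B_mono[of s t] countable_subset by (auto simp: Q_def)
  qed
  have "\<exists>t\<in>Q. prefix s t \<and> splits Q t" if s: "s \<in> Q" for s
  proof (rule ccontr)
    assume none: "\<not> ?thesis"
    define C where "C = {x \<in> B s. \<forall>t. through t x \<longrightarrow> t \<in> Q}"
    have "x = y" if xy: "x \<in> C" "y \<in> C" for x y
    proof (rule ccontr)
      assume "x \<noteq> y"
      then have "\<exists>n. x n \<noteq> y n" by blast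
      then obtain n where n: "x n \<noteq> y n" "\<And>m. m < n \<Longrightarrow> x m = y m"
        using exists_least_iff[of "\<lambda>n. x n \<noteq> y n"] by blast
      have t: "through (restr x n) y" using n(2) by (auto simp: through_def)
      have "restr x n @ [x n] \<in> Q" "restr x n @ [y n] \<in> Q" "restr x n \<in> Q"
        using xy t by (auto simp: C_def)
      then have "splits Q (restr x n)" using n(1) by (auto simp: splits_def succs_def)
      moreover have "length s \<le> n"
      proof (rule ccontr)
        assume "\<not> length s \<le> n"
        with xy have "x n = y n" by (auto simp: C_def B_def through_def)
        with n(1) show False by blast
      qed
      then have "prefix s (restr x n)"
        using xy by (intro through_comparable[of _ x]) (auto simp: C_def B_def)
      ultimately show False using none \<open>restr x n \<in> Q\<close> by blast
    qed
    then have "C = {} \<or> (\<exists>c. C = {c})" by blast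
    then have "countable C" by auto
    moreover have "countable (\<Union>t\<in>-Q. B t)"
      by (intro countable_UN) (auto simp: Q_def)
    moreover have "B s \<subseteq> C \<union> (\<Union>t\<in>-Q. B t)" by (auto simp: C_def B_def)
    ultimately have "countable (B s)" by (meson countable_Un countable_subset)
    with s show False by (simp add: Q_def)
  qed
  with tree have "Q \<in> Sacks" by (simp add: Sacks_def)
  with sub show ?thesis using that by blast
qed

section \<open>The transfinite construction\<close>

text \<open>
  Trees are themselves subsets of the countable set \<^typ>\<open>nat list\<close>, so this
  cardinal both measures the size of bodies and serves as a well-order of all trees in which every
  initial segment is smaller than the continuum.
\<close>

abbreviation continuum :: "nat list set rel" where
  "continuum \<equiv> |UNIV :: nat list set set|"

lemma continuum_ordLeq:
  fixes f :: "(nat \<Rightarrow> bool) \<Rightarrow> 'b"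
  assumes "inj f" "range f \<subseteq> A"
  shows "continuum \<le>o |A|"
proof -
  define g :: "nat list set \<Rightarrow> 'b" where "g X = f (\<lambda>n. from_nat n \<in> X)" for X
  have "inj g"
  proof (rule injI)
    fix X Y assume "g X = g Y"
    then have "(\<lambda>n. from_nat n \<in> X) = (\<lambda>n. from_nat n \<in> Y)" using assms(1) by (auto simp: g_def dest: injD)
    then have "from_nat (to_nat t) \<in> X \<longleftrightarrow> from_nat (to_nat t) \<in> Y" for t :: "nat list" by meson
    then show "X = Y" by auto
  qed
  moreover have "range g \<subseteq> A" using assms(2) by (auto simp: g_def)
  ultimately show ?thesis using card_of_ordLeq[of UNIV A] by blast
qed

lemma underS_continuum: "|underS continuum T| <o continuum"
  by (rule card_of_underS[OF card_of_Card_order]) (simp add: Field_card_of)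

lemma continuum_total: "S \<noteq> T \<Longrightarrow> S \<in> underS continuum T \<or> T \<in> underS continuum S"
  using card_of_well_order_on[of "UNIV :: nat list set set"]
  by (auto simp: well_order_on_def linear_order_on_def total_on_def underS_def)

lemma small_UNION:
  assumes I: "|I| <o continuum" and C: "\<And>i. i \<in> I \<Longrightarrow> countable (C i)"
  shows "|\<Union>i\<in>I. C i| <o continuum"
proof -
  \<comment> \<open>Adding a countably infinite summand bounds the union also when
  \<open>I\<close> is finite.\<close>
  define B where "B = I <+> (UNIV :: nat list set)"
  have inf: "infinite (UNIV :: nat list set)" by (rule infinite_UNIV_listI)
  have B: "|B| <o continuum" unfolding B_def
    using card_of_Pow[of "UNIV :: nat list set"] inf I
    by (intro card_of_Plus_ordLess_infinite) (auto simp: Finite_Set.finite_set)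
  have infB: "infinite B" using inf by (simp add: B_def)
  have "|C i| \<le>o |B|" if "i \<in> I" for i
  proof -
    have "|C i| \<le>o |UNIV :: nat set|" using C[OF that] unfolding card_of_ordLeq[symmetric] countable_def by auto
    moreover have "|UNIV :: nat set| \<le>o |B|" using infB infinite_iff_card_of_nat by blast
    ultimately show ?thesis using ordLeq_transitive by blast
  qed
  moreover have "|I| \<le>o |B|" unfolding B_def by (rule card_of_Plus1)
  ultimately have "|\<Union>i\<in>I. C i| \<le>o |B|" using infB by (intro card_of_UNION_ordLeq_infinite) auto
  then show ?thesis using B ordLeq_ordLess_trans by blast
qed

lemma small_countable: "countable A \<Longrightarrow> |A| <o continuum"
proof -
  have "|{[]} :: nat list set| <o continuum"
    by (intro finite_ordLess_infinite card_of_Well_order)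
      (simp_all add: Finite_Set.finite_set infinite_UNIV_listI Field_card_of)
  then show "countable A \<Longrightarrow> |A| <o continuum" using small_UNION[of "{[]}" "\<lambda>_. A"] by simp
qed

text \<open>
  A choice between \<open>z (2 * i)\<close> and \<open>z (2 * i + 1)\<close> for every
  \<open>i\<close>, where \<open>z\<close> enumerates part of \<open>Z\<close>, always gives an
  infinite set.
\<close>

lemma many_subsets:
  fixes Z :: "nat set"
  assumes Z: "infinite Z" and s: "s \<inter> Z = {}"
  shows "continuum \<le>o |{s \<union> S | S. S \<subseteq> Z \<and> infinite S}|"
proof -
  obtain z :: "nat \<Rightarrow> nat" where z: "inj z" "range z \<subseteq> Z" using infinite_countable_subset[OF Z] by blast
  define f where "f y = range (\<lambda>i. z (2 * i + of_bool (y i)))" for y :: "nat \<Rightarrow> bool"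
  have odd: "z (2 * i + 1) \<in> f y \<longleftrightarrow> y i" for i y
  proof
    assume "z (2 * i + 1) \<in> f y"
    then obtain j where "z (2 * i + 1) = z (2 * j + of_bool (y j))" by (auto simp: f_def)
    then have "2 * i + 1 = 2 * j + of_bool (y j)" by (rule injD[OF z(1)])
    then show "y i" by (cases "y j") (auto, presburger)
  next
    assume "y i"
    then show "z (2 * i + 1) \<in> f y" unfolding f_def by (intro image_eqI[of _ _ i]) auto
  qed
  show ?thesis
  proof (rule continuum_ordLeq)
    show "inj (\<lambda>y. s \<union> f y)"
    proof (rule injI)
      fix y y' assume eq: "s \<union> f y = s \<union> f y'"
      have "z (2 * i + 1) \<notin> s" for i using z(2) s by blast
      then have "y i = y' i" for i using eq odd[of i y] odd[of i y'] by blast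
      then show "y = y'" by blast
    qed
    show "range (\<lambda>y. s \<union> f y) \<subseteq> {s \<union> S | S. S \<subseteq> Z \<and> infinite S}"
    proof safe
      fix y
      have "inj (\<lambda>i. z (2 * i + of_bool (y i)))"
      proof (rule injI)
        fix i j assume "z (2 * i + of_bool (y i)) = z (2 * j + of_bool (y j))"
        then have "2 * i + of_bool (y i) = 2 * j + (of_bool (y j) :: nat)" by (rule injD[OF z(1)])
        then have "(2 * i + of_bool (y i)) div 2 = (2 * j + of_bool (y j)) div (2 :: nat)" by simp
        moreover have "(2 * k + of_bool b) div 2 = (k :: nat)" for k b by (cases b) auto
        ultimately show "i = j" by simp
      qed
      then have "infinite (f y)" by (simp add: f_def finite_image_iff)
      moreover have "f y \<subseteq> Z" using z(2) by (auto simp: f_def)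
      ultimately show "\<exists>S. s \<union> f y = s \<union> S \<and> S \<subseteq> Z \<and> infinite S" by blast
    qed
  qed
qed

lemma splittable_avoid:
  assumes "splittable \<T>" "P \<in> \<T>" "|A| <o continuum"
  shows "\<exists>Q\<in>\<T>. Q \<subseteq> P \<and> body Q \<inter> A = {}"
proof (rule ccontr)
  assume none: "\<not> ?thesis"
  obtain Q :: "(nat \<Rightarrow> bool) \<Rightarrow> nat list set" where Q: "\<forall>y. Q y \<in> \<T> \<and> Q y \<subseteq> P"
    "\<forall>y z. y \<noteq> z \<longrightarrow> body (Q y) \<inter> body (Q z) = {}"
    using bspec[OF assms(1)[unfolded splittable_def] assms(2)] by blast
  have "\<forall>y. \<exists>x. x \<in> body (Q y) \<inter> A" using Q(1) none by blast
  from choice[OF this] obtain x where x: "\<And>y. x y \<in> body (Q y)" "\<And>y. x y \<in> A" by blast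
  have "inj x"
  proof (rule injI)
    fix y z assume "x y = x z"
    then have "x y \<in> body (Q y) \<inter> body (Q z)" using x(1)[of y] x(1)[of z] by simp
    then show "y = z" using Q(2) by blast
  qed
  then have "continuum \<le>o |A|" using x(2) by (intro continuum_ordLeq) auto
  with assms(3) show False using not_ordLess_ordLeq by blast
qed

lemma Sacks_body_large:
  assumes P: "P \<in> Sacks" shows "continuum \<le>o |body P|"
proof (rule ccontr)
  assume "\<not> ?thesis"
  then have "|body P| <o continuum" by (simp add: not_ordLeq_iff_ordLess card_of_Well_order)
  then obtain Q where Q: "Q \<in> Sacks" "Q \<subseteq> P" "body Q \<inter> body P = {}"
    using splittable_avoid[OF splittable_Sacks P] by blast
  with Sacks_body_nonempty[OF Q(1)] body_mono show False by blast
qed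

text \<open>
  The point \<open>x T\<close> is picked in \<open>R T\<close> off the countable traces of
  \<open>Q P\<close> for all \<open>P\<close> that come before \<open>T\<close>. So
  \<open>Q P\<close> contains only points \<open>x T\<close> with \<open>T\<close> at or before
  \<open>P\<close>, apart from the one exceptional tree \<open>E P\<close>, and one of the many
  disjoint subtrees of \<open>Q P\<close> avoids all these points. Since \<open>Q\<close> and
  \<open>E\<close> do not depend on the chosen points, the choice needs no recursion.
\<close>

lemma bernstein_from_disjoint_pieces:
  assumes sub: "\<T> \<subseteq> \<S>" and split: "splittable \<S>"
    and R_sub: "\<And>T. T \<in> \<T> \<Longrightarrow> R T \<subseteq> body T"
    and R_disj: "\<And>T T'. T \<in> \<T> \<Longrightarrow> T' \<in> \<T> \<Longrightarrow> T \<noteq> T' \<Longrightarrow> R T \<inter> R T' = {}"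
    and R_large: "\<And>T. T \<in> \<T> \<Longrightarrow> continuum \<le>o |R T|"
    and thin: "\<And>P. P \<in> \<S> \<Longrightarrow> \<exists>Q\<in>\<S>. Q \<subseteq> P \<and> (\<exists>T0. \<forall>T\<in>\<T>. T \<noteq> T0 \<longrightarrow> countable (body Q \<inter> R T))"
    and nonempty: "\<And>P. P \<in> \<S> \<Longrightarrow> body P \<noteq> {}"
  shows "\<exists>B. bernstein \<T> B \<and> B \<in> tree_null \<S>"
proof -
  obtain Q E where Q: "\<And>P. P \<in> \<S> \<Longrightarrow> Q P \<in> \<S>" "\<And>P. P \<in> \<S> \<Longrightarrow> Q P \<subseteq> P"
    "\<And>P T. P \<in> \<S> \<Longrightarrow> T \<in> \<T> \<Longrightarrow> T \<noteq> E P \<Longrightarrow> countable (body (Q P) \<inter> R T)"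
  proof -
    have "\<forall>P\<in>\<S>. \<exists>Q. Q \<in> \<S> \<and> Q \<subseteq> P \<and> (\<exists>E. \<forall>T\<in>\<T>. T \<noteq> E \<longrightarrow> countable (body Q \<inter> R T))"
    proof
      fix P assume "P \<in> \<S>"
      from thin[OF this] show "\<exists>Q. Q \<in> \<S> \<and> Q \<subseteq> P \<and>
          (\<exists>E. \<forall>T\<in>\<T>. T \<noteq> E \<longrightarrow> countable (body Q \<inter> R T))"
        unfolding Bex_def .
    qed
    from bchoice[OF this] obtain Q where Q: "\<forall>P\<in>\<S>. Q P \<in> \<S> \<and> Q P \<subseteq> P \<and>
        (\<exists>E. \<forall>T\<in>\<T>. T \<noteq> E \<longrightarrow> countable (body (Q P) \<inter> R T))" by (rule exE)
    then have "\<forall>P\<in>\<S>. \<exists>E. \<forall>T\<in>\<T>. T \<noteq> E \<longrightarrow> countable (body (Q P) \<inter> R T)" by simp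
    from bchoice[OF this] obtain E where
      E: "\<forall>P\<in>\<S>. \<forall>T\<in>\<T>. T \<noteq> E P \<longrightarrow> countable (body (Q P) \<inter> R T)" by (rule exE)
    then show thesis using that[of Q E] Q by simp
  qed
  define bad where "bad T = (\<Union>P\<in>{P \<in> underS continuum T. P \<in> \<S> \<and> T \<noteq> E P}. body (Q P) \<inter> R T)" for T
  have "|bad T| <o continuum" if "T \<in> \<T>" for T
    unfolding bad_def
  proof (rule small_UNION)
    show "|{P \<in> underS continuum T. P \<in> \<S> \<and> T \<noteq> E P}| <o continuum"
      by (rule ordLeq_ordLess_trans[OF card_of_mono1 underS_continuum]) blast
  qed (use Q(3) that in auto)
  then have "\<exists>x. x \<in> R T \<and> x \<notin> bad T" if "T \<in> \<T>" for T
    using R_large[OF that] card_of_mono1[of "R T" "bad T"] that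
      not_ordLess_ordLeq ordLeq_transitive by (metis subsetI)
  then obtain x where x: "\<And>T. T \<in> \<T> \<Longrightarrow> x T \<in> R T" "\<And>T. T \<in> \<T> \<Longrightarrow> x T \<notin> bad T" by metis
  define B where "B = x ` \<T>"
  have null: "\<exists>Q'\<in>\<S>. Q' \<subseteq> P \<and> body Q' \<inter> B = {}" if P: "P \<in> \<S>" for P
  proof -
    have "B \<inter> body (Q P) \<subseteq> x ` underS continuum P \<union> {x P, x (E P)}"
    proof
      fix z assume z: "z \<in> B \<inter> body (Q P)"
      then obtain T where T: "T \<in> \<T>" "z = x T" by (auto simp: B_def)
      show "z \<in> x ` underS continuum P \<union> {x P, x (E P)}"
      proof (rule ccontr)
        assume "\<not> ?thesis"
        then have "T \<notin> underS continuum P" "T \<noteq> P" "T \<noteq> E P" using T by auto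
        then have "P \<in> underS continuum T" using continuum_total by blast
        then have "z \<in> bad T" using z T P x(1)[OF T(1)] \<open>T \<noteq> E P\<close> by (auto simp: bad_def)
        with x(2) T show False by blast
      qed
    qed
    moreover have "|x ` underS continuum P \<union> {x P, x (E P)}| <o continuum"
    proof (rule card_of_Un_ordLess_infinite)
      show "infinite (UNIV :: nat list set set)" by (simp add: Finite_Set.finite_set infinite_UNIV_listI)
      show "|x ` underS continuum P| <o continuum"
        by (rule ordLeq_ordLess_trans[OF card_of_image underS_continuum])
      show "|{x P, x (E P)}| <o continuum" by (rule small_countable) simp
    qed
    ultimately have "|B \<inter> body (Q P)| <o continuum"
      by (rule ordLeq_ordLess_trans[OF card_of_mono1])
    then obtain Q' where Q': "Q' \<in> \<S>" "Q' \<subseteq> Q P" "body Q' \<inter> (B \<inter> body (Q P)) = {}"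
      using splittable_avoid[OF split Q(1)[OF P]] by blast
    show ?thesis
    proof (intro bexI[of _ Q'] conjI)
      show "Q' \<subseteq> P" using Q'(2) Q(2)[OF P] by (rule subset_trans)
      show "body Q' \<inter> B = {}" using Q'(3) body_mono[OF Q'(2)] by auto
    qed (rule Q'(1))
  qed
  have "B \<inter> body T \<noteq> {} \<and> body T - B \<noteq> {}" if T: "T \<in> \<T>" for T
  proof
    show "B \<inter> body T \<noteq> {}" using x(1)[OF T] R_sub[OF T] T by (auto simp: B_def)
    obtain Q' where "Q' \<in> \<S>" "Q' \<subseteq> T" "body Q' \<inter> B = {}" using null T sub by blast
    then show "body T - B \<noteq> {}" using nonempty[of Q'] body_mono[of Q' T] by blast
  qed
  with null show ?thesis
    unfolding bernstein_def tree_null_def by (intro exI[of _ B]) simp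
qed

section \<open>Eventual domination and minimal families\<close>

definition dominated :: "(nat \<Rightarrow> nat) \<Rightarrow> (nat \<Rightarrow> nat) \<Rightarrow> bool" (infix "\<preceq>" 50) where
  "f \<preceq> g \<longleftrightarrow> (\<forall>\<^sub>F n in sequentially. f n \<le> g n)"

lemma dominated_trans:
  assumes "f \<preceq> g" "g \<preceq> h" shows "f \<preceq> h"
  using assms unfolding dominated_def by eventually_elim simp

lemma dominated_if_le: "(\<And>n. f n \<le> g n) \<Longrightarrow> f \<preceq> g"
  by (simp add: dominated_def)

text \<open>
  A monotone majorant of both \<open>f\<close> and the identity.
\<close>

definition accumulate :: "(nat \<Rightarrow> nat) \<Rightarrow> nat \<Rightarrow> nat" where
  "accumulate f v = v + (\<Sum>w\<le>v. f w)"

lemma accumulate_ge: "v \<le> accumulate f v" "f v \<le> accumulate f v"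
  using member_le_sum[of v "{..v}" f] by (auto simp: accumulate_def)

lemma mono_accumulate: "mono (accumulate f)"
  by (auto simp: accumulate_def mono_def intro!: add_mono sum_mono2)

text \<open>
  If \<open>c (Suc n) \<le> h (c n)\<close> from \<open>N\<close> on, then \<open>c\<close>
  is bounded by iterates of a monotone majorant of \<open>h\<close> started at
  \<open>c N\<close>, and \<open>n\<close>-fold iteration started at \<open>n\<close> eventually
  exceeds all of them. A single \<open>G\<close> therefore works for all sequences; it turns a
  statement about growth from one value of \<open>c\<close> to the next into one about eventual
  domination, to which minimality of a family applies.
\<close>

lemma escape_bound:
  "\<exists>G. \<forall>c. \<not> c \<preceq> G \<longrightarrow> (\<exists>\<^sub>F n in sequentially. h (c n) < c (Suc n))"
proof -
  define h' where "h' = accumulate h"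
  have incr: "v \<le> (h' ^^ k) v" for k v
    by (induction k) (auto intro: order_trans[OF _ accumulate_ge(1)] simp: h'_def)
  have mono: "(h' ^^ k) v \<le> (h' ^^ k) w" if "v \<le> w" for k v w
    using that by (induction k) (auto simp: h'_def intro: monoD[OF mono_accumulate])
  define G where "G n = (h' ^^ n) n" for n
  have "c \<preceq> G" if "\<not> (\<exists>\<^sub>F n in sequentially. h (c n) < c (Suc n))" for c
  proof -
    from that obtain N where N: "\<And>n. n \<ge> N \<Longrightarrow> c (Suc n) \<le> h (c n)"
      by (auto simp: frequently_def eventually_sequentially not_less)
    have c: "c (N + k) \<le> (h' ^^ k) (c N)" for k
    proof (induction k)
      case (Suc k)
      have "c (N + Suc k) \<le> h' (c (N + k))"
        using N[of "N + k"] accumulate_ge(2)[of h "c (N + k)"] by (simp add: h'_def)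
      also have "\<dots> \<le> h' ((h' ^^ k) (c N))" using Suc by (simp add: h'_def monoD[OF mono_accumulate])
      finally show ?case by simp
    qed simp
    have "c n \<le> G n" if n: "n \<ge> N + c N" for n
    proof -
      have "c n \<le> (h' ^^ (n - N)) (c N)" using c[of "n - N"] n by simp
      also have "\<dots> \<le> (h' ^^ (n - N)) n" using n by (intro mono) simp
      also have "\<dots> \<le> (h' ^^ N) ((h' ^^ (n - N)) n)" by (rule incr)
      also have "\<dots> = G n" using n by (simp add: G_def flip: funpow_add comp_apply[of "h' ^^ N" "h' ^^ (n - N)"])
      finally show ?thesis .
    qed
    then show ?thesis by (auto simp: dominated_def eventually_sequentially)
  qed
  then show ?thesis by blast
qed

lemma minimal_cardinality:
  assumes "\<Phi> A" shows "\<exists>A. \<Phi> A \<and> (\<forall>B. \<Phi> B \<longrightarrow> |A| \<le>o |B| )"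
proof -
  have "{|A| | A. \<Phi> A} \<noteq> {}" "\<forall>r\<in>{|A| | A. \<Phi> A}. Card_order r"
    using assms card_of_Card_order by auto
  from exists_minim_Card_order[OF this] show ?thesis by auto
qed

text \<open>
  Minimality in use: an initial segment of a minimal family is too small to have the property, and
  so is any family indexed by it, for instance one built in the course of a recursion.
\<close>

lemma small_image_underS:
  assumes min: "\<And>B. \<Phi> B \<Longrightarrow> |A| \<le>o |B|" and \<xi>: "\<xi> \<in> A"
  shows "\<not> \<Phi> (f ` underS |A| \<xi>)"
proof
  assume "\<Phi> (f ` underS |A| \<xi>)"
  then have "|A| \<le>o |f ` underS |A| \<xi>|" by (rule min)
  moreover have "|f ` underS |A| \<xi>| <o |A|"
    using \<xi> by (intro ordLeq_ordLess_trans[OF card_of_image] card_of_underS card_of_Card_order)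
      (simp add: Field_card_of)
  ultimately show False using not_ordLess_ordLeq by blast
qed

lemma wf_underS_card: "wf {(\<eta>, \<xi>). \<eta> \<in> underS |A| \<xi>}"
proof -
  have "wf ( |A| - Id)" using card_of_well_order_on[of A] by (simp add: well_order_on_def)
  moreover have " |A| - Id = {(\<eta>, \<xi>). \<eta> \<in> underS |A| \<xi>}" by (auto simp: underS_def)
  ultimately show ?thesis by simp
qed

lemma card_total: "S \<in> A \<Longrightarrow> T \<in> A \<Longrightarrow> S \<noteq> T \<Longrightarrow> S \<in> underS |A| T \<or> T \<in> underS |A| S"
  using card_of_well_order_on[of A]
  by (auto simp: well_order_on_def linear_order_on_def total_on_def underS_def)

lemma underS_card_subset: "\<eta> \<in> underS |A| \<xi> \<Longrightarrow> \<eta> \<in> A"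
  unfolding underS_def using FieldI1[of \<eta> \<xi> "|A|"] by (simp add: Field_card_of)

lemma card_least:
  assumes "\<xi> \<in> A" "\<Phi> \<xi>" obtains \<xi>' where "\<xi>' \<in> A" "\<Phi> \<xi>'" "\<And>\<eta>. \<eta> \<in> underS |A| \<xi>' \<Longrightarrow> \<not> \<Phi> \<eta>"
proof -
  have "\<exists>\<xi>'\<in>{\<xi> \<in> A. \<Phi> \<xi>}. \<forall>\<eta>. (\<eta>, \<xi>') \<in> {(\<eta>, \<xi>). \<eta> \<in> underS |A| \<xi>} \<longrightarrow> \<eta> \<notin> {\<xi> \<in> A. \<Phi> \<xi>}"
    using wf_underS_card[of A, unfolded wf_eq_minimal, rule_format, of \<xi> "{\<xi> \<in> A. \<Phi> \<xi>}"] assms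
    by simp
  then obtain \<xi>' where *: "\<xi>' \<in> A" "\<Phi> \<xi>'" "\<And>\<eta>. \<eta> \<in> underS |A| \<xi>' \<Longrightarrow> \<eta> \<in> A \<Longrightarrow> \<not> \<Phi> \<eta>" by blast
  show ?thesis
  proof (rule that)
    show "\<not> \<Phi> \<eta>" if "\<eta> \<in> underS |A| \<xi>'" for \<eta>
      using *(3)[OF that underS_card_subset[OF that]] .
  qed (fact *)+
qed

lemma card_recursion:
  fixes \<Phi> :: "('a \<Rightarrow> 'b) \<Rightarrow> 'a \<Rightarrow> 'b \<Rightarrow> bool"
  assumes cong: "\<And>f g \<xi> c. (\<And>\<eta>. \<eta> \<in> underS |A| \<xi> \<Longrightarrow> f \<eta> = g \<eta>) \<Longrightarrow> \<Phi> f \<xi> c = \<Phi> g \<xi> c"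
    and step: "\<And>f \<xi>. \<xi> \<in> A \<Longrightarrow> \<exists>c. \<Phi> f \<xi> c"
  shows "\<exists>f. \<forall>\<xi>\<in>A. \<Phi> f \<xi> (f \<xi>)"
proof -
  have "\<exists>f. \<forall>\<xi>. \<xi> \<in> A \<longrightarrow> \<Phi> f \<xi> (f \<xi>)"
  proof (rule dependent_wf_choice[OF wf_underS_card[of A]])
    fix f g :: "'a \<Rightarrow> 'b" and \<xi> c
    assume "\<And>\<eta>. (\<eta>, \<xi>) \<in> {(\<eta>, \<xi>). \<eta> \<in> underS |A| \<xi>} \<Longrightarrow> f \<eta> = g \<eta>"
    then show "(\<xi> \<in> A \<longrightarrow> \<Phi> f \<xi> c) = (\<xi> \<in> A \<longrightarrow> \<Phi> g \<xi> c)" using cong[of \<xi> f g] by simp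
  qed (use step in blast)
  then show ?thesis by blast
qed

text \<open>
  Fewer than continuum many values are already taken whenever the next one has to be chosen.
\<close>

lemma injective_selection:
  fixes A :: "nat list set \<Rightarrow> 'a set"
  assumes large: "\<And>T. T \<in> \<T> \<Longrightarrow> continuum \<le>o |A T|"
  shows "\<exists>\<sigma>. (\<forall>T\<in>\<T>. \<sigma> T \<in> A T) \<and> inj_on \<sigma> \<T>"
proof -
  define \<Phi> where "\<Phi> f T c \<longleftrightarrow> (T \<in> \<T> \<longrightarrow> c \<in> A T \<and> c \<notin> f ` underS continuum T)"
    for f :: "nat list set \<Rightarrow> 'a" and T c
  have "\<exists>\<sigma>. \<forall>T\<in>UNIV. \<Phi> \<sigma> T (\<sigma> T)"
  proof (rule card_recursion)
    fix f :: "nat list set \<Rightarrow> 'a" and T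
    have small: "|f ` underS continuum T| <o continuum"
      by (rule ordLeq_ordLess_trans[OF card_of_image underS_continuum])
    show "\<exists>c. \<Phi> f T c"
    proof (cases "T \<in> \<T>")
      case True
      have "\<not> A T \<subseteq> f ` underS continuum T"
        using card_of_mono1[of "A T" "f ` underS continuum T"] large[OF True] small
          ordLeq_transitive not_ordLess_ordLeq by blast
      then show ?thesis by (auto simp: \<Phi>_def)
    qed (simp add: \<Phi>_def)
  next
    fix f f' :: "nat list set \<Rightarrow> 'a" and T c
    assume "\<And>S. S \<in> underS continuum T \<Longrightarrow> f S = f' S"
    then have "f ` underS continuum T = f' ` underS continuum T" by auto
    then show "\<Phi> f T c = \<Phi> f' T c" by (simp add: \<Phi>_def)
  qed
  then obtain \<sigma> where \<sigma>: "\<forall>T\<in>UNIV. \<Phi> \<sigma> T (\<sigma> T)" by (rule exE)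
  have "inj_on \<sigma> \<T>"
  proof (rule inj_onI, rule ccontr)
    fix S T assume ST: "S \<in> \<T>" "T \<in> \<T>" "\<sigma> S = \<sigma> T" "S \<noteq> T"
    have "\<sigma> T \<notin> \<sigma> ` underS continuum T" "\<sigma> S \<notin> \<sigma> ` underS continuum S"
      using \<sigma> ST(1,2) by (simp_all add: \<Phi>_def)
    then have "S \<notin> underS continuum T" "T \<notin> underS continuum S"
      using ST(3) by (metis imageI)+
    with continuum_total[OF ST(4)] show False by blast
  qed
  with \<sigma> show ?thesis by (auto simp: \<Phi>_def)
qed

section \<open>Miller trees against perfect trees\<close>

text \<open>
  From a bound \<open>v\<close> to \<open>h (Suc (h v))\<close>: room for a low jump, which
  stays below \<open>h v\<close>, and for a high jump, which starts above \<open>h v\<close>.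
\<close>

definition widen :: "(nat \<Rightarrow> nat) \<Rightarrow> nat \<Rightarrow> nat" where
  "widen h v = h (Suc (h v))"

text \<open>
  The index \<open>2 * n + 1\<close> absorbs a shift: branches of a coded tree start their
  jumps at some \<open>c i0\<close>, and \<open>i0 + n + 1 \<le> 2 * n + 1\<close> from
  \<open>n = i0\<close> on.
\<close>

definition envelope :: "(nat \<Rightarrow> nat) \<Rightarrow> (nat \<Rightarrow> nat) \<Rightarrow> nat \<Rightarrow> nat" where
  "envelope h c n = widen h (c (2 * n + 1))"

text \<open>
  The stages at which \<open>x\<close> makes a high jump. Only the values of \<open>x\<close>
  before it exceeds \<open>widen h (c i)\<close> for the first time are inspected, since values
  in the critical interval may recur at later stages.
\<close>

definition jumps :: "(nat \<Rightarrow> nat) \<Rightarrow> (nat \<Rightarrow> nat) \<Rightarrow> (nat \<Rightarrow> nat) \<Rightarrow> nat set" where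
  "jumps h c x = {i. \<exists>n. h (c i) < x n \<and> (\<forall>m\<le>n. x m \<le> widen h (c i))}"

definition below :: "nat list \<Rightarrow> nat \<Rightarrow> bool" where
  "below t v \<longleftrightarrow> length t \<le> v \<and> (\<forall>a\<in>set t. a \<le> v)"

lemma below_mono: "below t v \<Longrightarrow> v \<le> w \<Longrightarrow> below t w"
  by (auto simp: below_def)

lemma ex_below: "\<exists>v. below t v"
  by (intro exI[of _ "length t + sum_list t"]) (auto simp: below_def intro: member_le_sum_list le_trans[OF _ le_add2])

lemma finite_below: "finite {t. below t v}"
proof -
  have "{t. below t v} = {t. set t \<subseteq> {..v} \<and> length t \<le> v}" by (auto simp: below_def)
  then show ?thesis by (simp add: finite_lists_length_le)
qed

text \<open>
  Only finitely many nodes are below \<open>w\<close>, so the next splitting nodes chosen for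
  them, after a successor of size at least \<open>w\<close>, have a common bound.
\<close>

lemma bounded_next_split:
  assumes M: "M \<in> Miller"
  shows "\<exists>f. \<forall>t w. inf_split M t \<longrightarrow> below t w \<longrightarrow>
    (\<exists>a s. w \<le> a \<and> prefix (t @ [a]) s \<and> inf_split M s \<and> below s (f w))"
proof -
  have "\<exists>s v. inf_split M t \<longrightarrow> (\<exists>a\<ge>w. prefix (t @ [a]) s) \<and> inf_split M s \<and> below s v" for t w
  proof (cases "inf_split M t")
    case True
    then obtain a where a: "a \<in> succs M t" "a \<ge> w"
      unfolding inf_split_def by (meson infinite_nat_iff_unbounded_le)
    then obtain s where "prefix (t @ [a]) s" "inf_split M s"
      using MillerD(2)[OF M] by (auto simp: succs_def)
    with a ex_below[of s] show ?thesis by blast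
  qed auto
  then obtain s v where sv: "\<And>t w. inf_split M t \<Longrightarrow> (\<exists>a\<ge>w. prefix (t @ [a]) (s t w)) \<and> inf_split M (s t w)
      \<and> below (s t w) (v t w)" by metis
  define f where "f w = (\<Sum>t\<in>{t. below t w}. v t w)" for w
  show ?thesis
  proof (intro exI[of _ f] allI impI)
    fix t w assume t: "inf_split M t" "below t w"
    have "v t w \<le> f w" unfolding f_def using t(2) finite_below by (intro member_le_sum) auto
    then show "\<exists>a s. w \<le> a \<and> prefix (t @ [a]) s \<and> inf_split M s \<and> below s (f w)"
      using sv[OF t(1), of w] below_mono by blast
  qed
qed

text \<open>
  At stage \<open>i\<close> the current splitting node is below \<open>widen h (c i)\<close>,
  hence below \<open>c (Suc i)\<close>, and the branch takes a successor of size at least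
  \<open>c (Suc i)\<close> (low jump) or above \<open>h (c (Suc i))\<close> (high jump).
  Domination of \<open>f\<close> keeps the next splitting node below
  \<open>widen h (c (Suc i))\<close>, even below \<open>h (c (Suc i))\<close> after a low
  jump, which makes the two kinds of jump distinguishable.

  Every stage contains a jump from a position at most \<open>widen h (c n)\<close> to a value
  at least \<open>c (Suc n)\<close>. This is why a branch escapes every monotone
  \<open>G\<close> with \<open>G (widen h (c n)) < c (Suc n)\<close> for infinitely many
  \<open>n\<close>, whichever they are. The even stages carry the code \<open>z\<close>; the odd
  ones stay free.
\<close>

lemma Miller_coded_subtree:
  assumes M: "M \<in> Miller"
  shows "\<exists>f. \<forall>h c z. f \<preceq> h \<longrightarrow> mono h \<longrightarrow> (\<forall>v. v \<le> h v) \<longrightarrow> strict_mono c \<longrightarrow>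
      (\<forall>n. widen h (c n) < c (Suc n)) \<longrightarrow>
      (\<exists>T\<in>Sacks. T \<subseteq> M \<and> (\<forall>x\<in>body T. x \<preceq> envelope h c \<and>
        (\<forall>G. mono G \<longrightarrow> (\<exists>\<^sub>F n in sequentially. G (widen h (c n)) < c (Suc n)) \<longrightarrow> \<not> x \<preceq> G) \<and>
        (\<exists>i0. \<forall>i>i0. even i \<longrightarrow> (i \<in> jumps h c x \<longleftrightarrow> z i))))"
proof -
  obtain f where f: "\<forall>t w. inf_split M t \<longrightarrow> below t w \<longrightarrow>
    (\<exists>a s. w \<le> a \<and> prefix (t @ [a]) s \<and> inf_split M s \<and> below s (f w))"
    using bounded_next_split[OF M] by (rule exE)
  show ?thesis
  proof (intro exI[of _ f] allI impI)
    fix h c :: "nat \<Rightarrow> nat" and z :: "nat \<Rightarrow> bool"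
    assume fh: "f \<preceq> h" and mono_h: "mono h" and incr: "\<forall>v. v \<le> h v" and mono_c: "strict_mono c"
      and gaps: "\<forall>n. widen h (c n) < c (Suc n)"
    have incr_h: "v \<le> h v" for v using incr by blast
    have gap: "widen h (c n) < c (Suc n)" for n using gaps by blast
    have mono_w: "widen h v \<le> widen h w" if "v \<le> w" for v w
      using that mono_h by (auto simp: widen_def intro!: monoD[of h])
    have h_w: "h v \<le> widen h v" for v
      unfolding widen_def using incr_h[of "Suc (h v)"] by linarith
    have c_ge: "n \<le> c n" for n using mono_c by (rule strict_mono_imp_increasing)
    have c_mono: "c m \<le> c n" if "m \<le> n" for m n
      using that mono_c by (simp add: strict_mono_less_eq)
    obtain W where W: "\<And>n. n \<ge> W \<Longrightarrow> f n \<le> h n"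
      using fh by (auto simp: dominated_def eventually_sequentially)
    obtain t0 v0 where t0: "inf_split M t0" "below t0 v0" using MillerD(3)[OF M] ex_below by blast
    define i0 where "i0 = max W v0"
    define N where "N k t \<longleftrightarrow> inf_split M t \<and> below t (widen h (c (i0 + k)))" for k t
    define E where "E k t l s \<longleftrightarrow> (\<forall>b. c (i0 + Suc k) \<le> l b \<and> (b \<longrightarrow> h (c (i0 + Suc k)) < l b) \<and>
        (\<not> b \<longrightarrow> below (s b) (h (c (i0 + Suc k)))))"
      for k :: nat and t :: "nat list" and l :: "bool \<Rightarrow> nat" and s :: "bool \<Rightarrow> nat list"
    have base: "N 0 t0"
    proof -
      have "v0 \<le> widen h (c i0)"
        using c_ge[of i0] incr_h[of "c i0"] h_w[of "c i0"] by (simp add: i0_def)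
      with t0 below_mono show ?thesis by (auto simp: N_def)
    qed
    have step: "\<exists>l s. inj l \<and> (\<forall>b. N (Suc k) (s b) \<and> prefix (t @ [l b]) (s b)) \<and> E k t l s"
      if N: "N k t" for k t
    proof -
      define v where "v = c (i0 + Suc k)"
      define w where "w b = (if b then Suc (h v) else v)" for b
      have "below t v" using N gap[of "i0 + k"] by (auto simp: N_def v_def intro: below_mono)
      then have "below t (w b)" for b using incr_h[of v] by (auto simp: w_def intro: below_mono)
      then have "\<exists>a s. w b \<le> a \<and> prefix (t @ [a]) s \<and> inf_split M s \<and> below s (f (w b))" for b
        using f N by (auto simp: N_def)
      then obtain l s where ls: "\<And>b. w b \<le> l b" "\<And>b. prefix (t @ [l b]) (s b)" "\<And>b. inf_split M (s b)"
        "\<And>b. below (s b) (f (w b))" by metis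
      have "W \<le> v" using c_ge[of "i0 + Suc k"] by (simp add: v_def i0_def)
      then have "f (w b) \<le> h (w b)" for b using W[of "w b"] incr_h[of v] by (auto simp: w_def)
      then have bs: "below (s b) (h (w b))" for b using ls(4) below_mono by blast
      have sF: "below (s False) (h v)" using bs[of False] by (simp add: w_def)
      have "h (w b) \<le> widen h v" for b using h_w[of v] by (auto simp: w_def widen_def)
      then have s: "below (s b) (widen h v)" for b using bs below_mono by blast
      have "l False \<in> set (s False)" using ls(2)[of False] by (auto simp: prefix_def)
      then have lF: "l False \<le> h v" using sF by (auto simp: below_def)
      have lT: "h v < l True" using ls(1)[of True] by (simp add: w_def)
      have "inj l"
      proof (rule injI)
        show "a = b" if "l a = l b" for a b using that lF lT by (cases a; cases b) auto
      qed
      moreover have "E k t l s"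
        using ls(1)[of True] ls(1)[of False] sF lT incr_h[of v] unfolding E_def v_def[symmetric]
        by (auto simp: w_def all_bool_eq split: if_splits)
      ultimately show ?thesis using ls s by (intro exI[of _ l] exI[of _ s]) (auto simp: N_def v_def)
    qed
    obtain \<tau> l where sch: "scheme \<tau> l" and N\<tau>: "\<And>u. N (length u) (\<tau> u)"
      and E\<tau>: "\<And>u. E (length u) (\<tau> u) (l u) (\<lambda>b. \<tau> (u @ [b]))"
      using scheme_exists[of N t0 E, OF base step] by blast
    define V where "V = {u. \<forall>k<length u. k \<in> {k. even (i0 + Suc k)} \<longrightarrow> u ! k = z (i0 + Suc k)}"
    have "\<exists>k\<ge>n. k \<notin> {k. even (i0 + Suc k)}" for n
      by (cases "even (i0 + Suc n)") (auto intro: exI[of _ n] exI[of _ "Suc n"])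
    then have "downset \<tau> V \<in> Sacks" unfolding V_def by (rule constrained_downset_Sacks[OF sch])
    moreover have "downset \<tau> V \<subseteq> M"
      using N\<tau> MillerD(1)[OF M] by (intro downset_subset) (auto simp: N_def inf_split_def)
    moreover have "x \<preceq> envelope h c \<and>
        (\<forall>G. mono G \<longrightarrow> (\<exists>\<^sub>F n in sequentially. G (widen h (c n)) < c (Suc n)) \<longrightarrow> \<not> x \<preceq> G) \<and>
        (\<exists>i0. \<forall>i>i0. even i \<longrightarrow> (i \<in> jumps h c x \<longleftrightarrow> z i))"
      if "x \<in> body (downset \<tau> V)" for x
    proof -
      have "\<exists>y. (\<forall>n. initial y n \<in> V) \<and> x = point \<tau> y"
        by (rule downset_branch[OF sch _ that]) (auto simp: V_def prefix_nth)
      then obtain y where yV: "\<And>n. initial y n \<in> V" and x: "x = point \<tau> y" by blast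
      define t where "t k = \<tau> (initial y k)" for k
      have thr: "through (t k) x" for k unfolding t_def x by (rule through_point[OF sch])
      have len: "k \<le> length (t k)" for k using scheme_length[OF sch, of "initial y k"] by (simp add: t_def)
      have bel: "below (t k) (widen h (c (i0 + k)))" for k
        using N\<tau>[of "initial y k"] by (simp add: N_def t_def)
      have x_le: "x n \<le> v" if "n < length (t k)" "below (t k) v" for n k v
        using that thr[of k] by (auto simp: through_def below_def)
      have jump: "x (length (t k)) = l (initial y k) (y k)" for k
        unfolding t_def x by (rule point_label[OF sch])
      have E: "E k (t k) (l (initial y k)) (\<lambda>b. \<tau> (initial y k @ [b]))" for k
        using E\<tau>[of "initial y k"] by (simp add: t_def)
      have jump_ge: "c (i0 + Suc k) \<le> x (length (t k))" for k
        using E[of k] by (simp add: E_def jump)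
      have "x \<preceq> envelope h c"
        unfolding dominated_def eventually_sequentially
      proof (intro exI[of _ i0] allI impI)
        fix n assume n: "i0 \<le> n"
        have "x n \<le> widen h (c (i0 + Suc n))" using len[of "Suc n"] bel[of "Suc n"] by (intro x_le[of _ "Suc n"]) auto
        also have "\<dots> \<le> envelope h c n" unfolding envelope_def using n by (intro mono_w c_mono) simp
        finally show "x n \<le> envelope h c n" .
      qed
      moreover have "\<not> x \<preceq> G" if G: "mono G" "\<exists>\<^sub>F n in sequentially. G (widen h (c n)) < c (Suc n)" for G
      proof
        assume "x \<preceq> G"
        then obtain N0 where N0: "\<And>n. n \<ge> N0 \<Longrightarrow> x n \<le> G n" by (auto simp: dominated_def eventually_sequentially)
        obtain i where i: "i \<ge> i0 + N0" "G (widen h (c i)) < c (Suc i)"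
          using G(2) by (auto simp: frequently_sequentially)
        define k where "k = i - i0"
        have "length (t k) \<le> widen h (c i)" using bel[of k] i(1) by (simp add: below_def k_def)
        then have "G (length (t k)) \<le> G (widen h (c i))" using G(1) by (simp add: monoD)
        moreover have "c (Suc i) \<le> x (length (t k))" using jump_ge[of k] i(1) by (simp add: k_def)
        moreover have "x (length (t k)) \<le> G (length (t k))"
          using len[of k] i(1) by (intro N0) (simp add: k_def)
        ultimately show False using i(2) by linarith
      qed
      moreover have "i \<in> jumps h c x \<longleftrightarrow> z i" if i: "i > i0" "even i" for i
      proof -
        define k where "k = i - Suc i0"
        have ik: "i = i0 + Suc k" using i by (simp add: k_def)
        have "z i = y k" using yV[of "Suc k"] i(2) by (auto simp: V_def ik)
        moreover have "i \<in> jumps h c x" if "y k"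
        proof -
          have "h (c i) < x (length (t k))" using E[of k] that by (auto simp: E_def jump ik)
          moreover have "x m \<le> widen h (c i)" if "m \<le> length (t k)" for m
          proof (rule x_le)
            have "length (t k) < length (t (Suc k))"
              using prefix_length_le[OF scheme_step[OF sch, of "initial y k" "y k"]]
              by (simp add: t_def initial_Suc)
            with that show "m < length (t (Suc k))" by simp
            show "below (t (Suc k)) (widen h (c i))" using bel[of "Suc k"] by (simp add: ik)
          qed
          ultimately show ?thesis by (auto simp: jumps_def)
        qed
        moreover have "y k" if "i \<in> jumps h c x"
        proof (rule ccontr)
          assume "\<not> y k"
          then have b: "below (t (Suc k)) (h (c i))"
            using E[of k] by (auto simp: E_def t_def initial_Suc ik)
          from that obtain n where n: "h (c i) < x n" "\<And>m. m \<le> n \<Longrightarrow> x m \<le> widen h (c i)"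
            by (auto simp: jumps_def)
          have "length (t (Suc k)) \<le> n"
          proof (rule ccontr)
            assume "\<not> ?thesis"
            then have "x n \<le> h (c i)" using b by (intro x_le) auto
            with n(1) show False by simp
          qed
          then have "x (length (t (Suc k))) \<le> widen h (c i)" by (rule n(2))
          moreover have "c (Suc i) \<le> x (length (t (Suc k)))" using jump_ge[of "Suc k"] by (simp add: ik)
          ultimately show False using gap[of i] by simp
        qed
        ultimately show ?thesis by blast
      qed
      ultimately show ?thesis by blast
    qed
    ultimately show "\<exists>T\<in>Sacks. T \<subseteq> M \<and> (\<forall>x\<in>body T. x \<preceq> envelope h c \<and>
        (\<forall>G. mono G \<longrightarrow> (\<exists>\<^sub>F n in sequentially. G (widen h (c n)) < c (Suc n)) \<longrightarrow> \<not> x \<preceq> G) \<and>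
        (\<exists>i0. \<forall>i>i0. even i \<longrightarrow> (i \<in> jumps h c x \<longleftrightarrow> z i)))"
      by (intro bexI[of _ "downset \<tau> V"] conjI ballI) simp_all
  qed
qed

text \<open>
  The envelopes of the earlier indices, composed with the growth required at \<open>\<xi>\<close>,
  give bounds \<open>G \<eta>\<close> by \<open>escape_bound\<close>. There are too few of them
  to be dominating, so some \<open>b\<close> escapes each of them, and so does any sequence above
  \<open>b\<close>.
\<close>

lemma level_sequences:
  "\<exists>(D :: (nat \<Rightarrow> nat) set) c. (\<forall>f. \<exists>\<xi>\<in>D. f \<preceq> \<xi>) \<and> (\<forall>\<xi>\<in>D. strict_mono (c \<xi>) \<and>
      (\<forall>n. widen (accumulate \<xi>) (c \<xi> n) < c \<xi> (Suc n)) \<and> (\<forall>\<eta>\<in>underS |D| \<xi>. \<exists>\<^sub>F n in sequentially.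
        envelope (accumulate \<eta>) (c \<eta>) (widen (accumulate \<xi>) (c \<xi> n)) < c \<xi> (Suc n)))"
proof -
  define dominating where "dominating D \<longleftrightarrow> (\<forall>f. \<exists>\<xi>\<in>D. f \<preceq> \<xi>)" for D
  have "dominating UNIV" by (auto simp: dominating_def intro: dominated_if_le)
  then obtain D where D: "dominating D" "\<And>B. dominating B \<Longrightarrow> |D| \<le>o |B|"
    using minimal_cardinality[of dominating] by blast
  define \<Phi> where "\<Phi> c \<xi> d \<longleftrightarrow> strict_mono d \<and> (\<forall>n. widen (accumulate \<xi>) (d n) < d (Suc n)) \<and>
      (\<forall>\<eta>\<in>underS |D| \<xi>. \<exists>\<^sub>F n in sequentially.
        envelope (accumulate \<eta>) (c \<eta>) (widen (accumulate \<xi>) (d n)) < d (Suc n))"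
    for c \<xi> and d :: "nat \<Rightarrow> nat"
  have "\<exists>c. \<forall>\<xi>\<in>D. \<Phi> c \<xi> (c \<xi>)"
  proof (rule card_recursion)
    fix c \<xi> assume \<xi>: "\<xi> \<in> D"
    define w where "w = widen (accumulate \<xi>)"
    have "\<forall>\<eta>. \<exists>G. \<forall>d. \<not> d \<preceq> G \<longrightarrow> (\<exists>\<^sub>F n in sequentially. envelope (accumulate \<eta>) (c \<eta>) (w (d n)) < d (Suc n))"
      using escape_bound[of "\<lambda>v. envelope (accumulate \<eta>) (c \<eta>) (w v)" for \<eta>] by blast
    from choice[OF this] obtain G where
      G: "\<And>\<eta> d. \<not> d \<preceq> G \<eta> \<Longrightarrow> \<exists>\<^sub>F n in sequentially. envelope (accumulate \<eta>) (c \<eta>) (w (d n)) < d (Suc n)"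
      by blast
    have "\<not> dominating (G ` underS |D| \<xi>)" by (rule small_image_underS[OF D(2) \<xi>])
    then obtain b where b: "\<And>\<eta>. \<eta> \<in> underS |D| \<xi> \<Longrightarrow> \<not> b \<preceq> G \<eta>" by (auto simp: dominating_def)
    define d where "d = rec_nat (b 0) (\<lambda>n v. max (b (Suc n)) (Suc (w v)))"
    have d_Suc: "d (Suc n) = max (b (Suc n)) (Suc (w (d n)))" for n by (simp add: d_def)
    have "b n \<le> d n" for n by (cases n) (auto simp: d_def)
    then have esc: "\<not> d \<preceq> G \<eta>" if "\<eta> \<in> underS |D| \<xi>" for \<eta>
      using b[OF that] dominated_trans dominated_if_le by blast
    have w_ge: "v \<le> w v" for v
      unfolding w_def widen_def using accumulate_ge(1)[of v \<xi>] accumulate_ge(1)[of "Suc (accumulate \<xi> v)" \<xi>]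
      by linarith
    have gap: "w (d n) < d (Suc n)" for n by (simp add: d_Suc less_max_iff_disj)
    have "strict_mono d" unfolding strict_mono_Suc_iff using gap w_ge le_less_trans by blast
    with gap esc G show "\<exists>d. \<Phi> c \<xi> d" unfolding \<Phi>_def w_def[symmetric] by blast
  qed (auto simp: \<Phi>_def)
  then obtain c where c: "\<forall>\<xi>\<in>D. \<Phi> c \<xi> (c \<xi>)" by (rule exE)
  show ?thesis
    by (intro exI[of _ D] exI[of _ c]) (use D(1) c in \<open>simp add: dominating_def \<Phi>_def\<close>)
qed

lemma mono_envelope:
  assumes "mono h" "strict_mono c" shows "mono (envelope h c)"
  unfolding envelope_def widen_def
  by (intro monoI monoD[OF assms(1)] Suc_le_mono[THEN iffD2]) (simp add: strict_mono_less_eq[OF assms(2)])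

text \<open>
  The pieces are closed, so if one of them has an uncountable trace on a perfect tree, then it
  contains a perfect subtree of it, which is disjoint from all other pieces.
\<close>

lemma Miller_Bernstein_Sacks_null: "\<exists>B. bernstein Miller B \<and> B \<in> tree_null Sacks"
proof -
  obtain D :: "(nat \<Rightarrow> nat) set" and c where D: "\<And>f. \<exists>\<xi>\<in>D. f \<preceq> \<xi>"
    and mono_c: "\<And>\<xi>. \<xi> \<in> D \<Longrightarrow> strict_mono (c \<xi>)"
    and gap: "\<And>\<xi> n. \<xi> \<in> D \<Longrightarrow> widen (accumulate \<xi>) (c \<xi> n) < c \<xi> (Suc n)"
    and esc: "\<And>\<xi> \<eta>. \<xi> \<in> D \<Longrightarrow> \<eta> \<in> underS |D| \<xi> \<Longrightarrow>
      \<exists>\<^sub>F n in sequentially. envelope (accumulate \<eta>) (c \<eta>) (widen (accumulate \<xi>) (c \<xi> n)) < c \<xi> (Suc n)"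
    using level_sequences by blast
  define K where "K \<xi> = envelope (accumulate \<xi>) (c \<xi>)" for \<xi>
  \<comment> \<open>Every node is consulted at infinitely many even stages, so the codes of two
  different trees differ beyond any given stage.\<close>
  define z :: "nat list set \<Rightarrow> nat \<Rightarrow> bool" where "z M i \<longleftrightarrow> from_nat (fst (prod_decode (i div 2))) \<in> M" for M i
  have z_inj: "\<exists>i>n. even i \<and> z M i \<noteq> z M' i" if neq: "M \<noteq> M'" for M M' n
  proof -
    obtain t where t: "t \<in> M \<longleftrightarrow> t \<notin> M'" using neq by blast
    define i where "i = 2 * prod_encode (to_nat t, Suc n)"
    have "Suc n \<le> prod_encode (to_nat t, Suc n)" by (rule le_prod_encode_2)
    then have "i > n" by (simp add: i_def)
    moreover have "z M i \<noteq> z M' i" using t by (simp add: z_def i_def)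
    ultimately show ?thesis by (intro exI[of _ i]) (simp add: i_def)
  qed
  define piece where "piece M \<xi> T \<longleftrightarrow> \<xi> \<in> D \<and> T \<in> Sacks \<and> T \<subseteq> M \<and> (\<forall>x\<in>body T. x \<preceq> K \<xi> \<and>
      (\<forall>\<eta>\<in>underS |D| \<xi>. \<not> x \<preceq> K \<eta>) \<and>
      (\<exists>i0. \<forall>i>i0. even i \<longrightarrow> (i \<in> jumps (accumulate \<xi>) (c \<xi>) x \<longleftrightarrow> z M i)))" for M \<xi> T
  have "\<exists>p. piece M (fst p) (snd p)" if M: "M \<in> Miller" for M
  proof -
    obtain f where f: "\<forall>h c z. f \<preceq> h \<longrightarrow> mono h \<longrightarrow> (\<forall>v. v \<le> h v) \<longrightarrow> strict_mono c \<longrightarrow>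
      (\<forall>n. widen h (c n) < c (Suc n)) \<longrightarrow>
      (\<exists>T\<in>Sacks. T \<subseteq> M \<and> (\<forall>x\<in>body T. x \<preceq> envelope h c \<and>
        (\<forall>G. mono G \<longrightarrow> (\<exists>\<^sub>F n in sequentially. G (widen h (c n)) < c (Suc n)) \<longrightarrow> \<not> x \<preceq> G) \<and>
        (\<exists>i0. \<forall>i>i0. even i \<longrightarrow> (i \<in> jumps h c x \<longleftrightarrow> z i))))"
      using Miller_coded_subtree[OF M] by (rule exE)
    obtain \<xi> where \<xi>: "\<xi> \<in> D" "f \<preceq> \<xi>" using D by blast
    have "f \<preceq> accumulate \<xi>" using \<xi>(2) dominated_if_le[OF accumulate_ge(2)] by (rule dominated_trans)
    from f[rule_format, OF this mono_accumulate accumulate_ge(1) mono_c[OF \<xi>(1)] gap[OF \<xi>(1)], of "z M"]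
    obtain T where T: "T \<in> Sacks" "T \<subseteq> M" and x: "\<And>x. x \<in> body T \<Longrightarrow> x \<preceq> K \<xi> \<and>
        (\<forall>G. mono G \<longrightarrow> (\<exists>\<^sub>F n in sequentially. G (widen (accumulate \<xi>) (c \<xi> n)) < c \<xi> (Suc n)) \<longrightarrow> \<not> x \<preceq> G) \<and>
        (\<exists>i0. \<forall>i>i0. even i \<longrightarrow> (i \<in> jumps (accumulate \<xi>) (c \<xi>) x \<longleftrightarrow> z M i))"
      unfolding K_def by blast
    have "mono (K \<eta>) \<and> (\<exists>\<^sub>F n in sequentially. K \<eta> (widen (accumulate \<xi>) (c \<xi> n)) < c \<xi> (Suc n))"
      if "\<eta> \<in> underS |D| \<xi>" for \<eta>
    proof
      have "\<eta> \<in> D" using that by (rule underS_card_subset)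
      then show "mono (K \<eta>)" unfolding K_def by (intro mono_envelope mono_accumulate mono_c)
    qed (use esc[OF \<xi>(1) that] in \<open>simp add: K_def\<close>)
    with \<xi>(1) T x have "piece M \<xi> T" unfolding piece_def by blast
    then show ?thesis by (intro exI[of _ "(\<xi>, T)"]) simp
  qed
  then have "\<forall>M\<in>Miller. \<exists>p. piece M (fst p) (snd p)" by blast
  from bchoice[OF this] obtain p where p: "\<forall>M\<in>Miller. piece M (fst (p M)) (snd (p M))" by (rule exE)
  define \<xi> T where "\<xi> M = fst (p M)" and "T M = snd (p M)" for M
  have \<xi>: "\<And>M. M \<in> Miller \<Longrightarrow> \<xi> M \<in> D"
    and T: "\<And>M. M \<in> Miller \<Longrightarrow> T M \<in> Sacks" "\<And>M. M \<in> Miller \<Longrightarrow> T M \<subseteq> M"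
    and level: "\<And>M x. M \<in> Miller \<Longrightarrow> x \<in> body (T M) \<Longrightarrow> x \<preceq> K (\<xi> M)"
      "\<And>M x \<eta>. M \<in> Miller \<Longrightarrow> x \<in> body (T M) \<Longrightarrow> \<eta> \<in> underS |D| (\<xi> M) \<Longrightarrow> \<not> x \<preceq> K \<eta>"
    and coded: "\<And>M x. M \<in> Miller \<Longrightarrow> x \<in> body (T M) \<Longrightarrow>
      \<exists>i0. \<forall>i>i0. even i \<longrightarrow> (i \<in> jumps (accumulate (\<xi> M)) (c (\<xi> M)) x \<longleftrightarrow> z M i)"
    using p unfolding piece_def \<xi>_def T_def by simp_all
  have disj: "body (T M) \<inter> body (T M') = {}" if M: "M \<in> Miller" "M' \<in> Miller" "M \<noteq> M'" for M M'
  proof (rule ccontr)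
    assume "\<not> ?thesis"
    then obtain x where x: "x \<in> body (T M)" "x \<in> body (T M')" by blast
    have same: "\<xi> M = \<xi> M'"
      using card_total[of "\<xi> M" D "\<xi> M'"] \<xi> M level x by blast
    obtain i1 i2 where i: "\<forall>i>i1. even i \<longrightarrow> (i \<in> jumps (accumulate (\<xi> M)) (c (\<xi> M)) x \<longleftrightarrow> z M i)"
      "\<forall>i>i2. even i \<longrightarrow> (i \<in> jumps (accumulate (\<xi> M)) (c (\<xi> M)) x \<longleftrightarrow> z M' i)"
      using coded[OF M(1) x(1)] coded[OF M(2) x(2)] unfolding same by blast
    obtain j where "j > max i1 i2" "even j" "z M j \<noteq> z M' j" using z_inj[OF M(3)] by blast
    then show False using i(1)[rule_format, of j] i(2)[rule_format, of j] by simp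
  qed
  show ?thesis
  proof (rule bernstein_from_disjoint_pieces[where R="\<lambda>M. body (T M)"])
    fix P assume P: "P \<in> Sacks"
    show "\<exists>Q\<in>Sacks. Q \<subseteq> P \<and> (\<exists>M0. \<forall>M\<in>Miller. M \<noteq> M0 \<longrightarrow> countable (body Q \<inter> body (T M)))"
    proof (cases "\<exists>M\<in>Miller. uncountable (body P \<inter> body (T M))")
      case False
      then show ?thesis using P by blast
    next
      case True
      then obtain M where M: "M \<in> Miller" "uncountable (body P \<inter> body (T M))" by blast
      have eq: "body P \<inter> body (T M) = body (P \<inter> T M)" by (auto simp: body_def)
      have "is_tree (P \<inter> T M)"
      proof -
        have "restr x 0 \<in> P \<inter> T M" if "x \<in> body (P \<inter> T M)" for x using that by (simp add: body_def)
        then have "P \<inter> T M \<noteq> {}" using M(2) eq by fastforce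
        then show ?thesis using P T(1)[OF M(1)] by (auto simp: Sacks_def is_tree_def)
      qed
      then obtain Q where Q: "Q \<in> Sacks" "Q \<subseteq> P \<inter> T M"
        using perfect_set_property M(2) unfolding eq by blast
      have "countable (body Q \<inter> body (T M'))" if "M' \<in> Miller" "M' \<noteq> M" for M'
      proof -
        have "body Q \<inter> body (T M') = {}" using disj[OF M(1) that(1)] that(2) body_mono[of Q "T M"] Q(2) by auto
        then show ?thesis by simp
      qed
      with Q show ?thesis by (intro bexI[of _ Q] conjI exI[of _ M]) auto
    qed
  qed (use Miller_subset_Sacks splittable_Sacks T body_mono disj Sacks_body_large Sacks_body_nonempty in auto)
qed

section \<open>Laver trees against Miller trees\<close>

text \<open>
  On a branch of rank \<open>\<xi>\<close> this set, taken for \<open>g \<xi>\<close>, is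
  infinite; it serves as the label that tells apart the pieces of equal rank.
\<close>

definition low :: "(nat \<Rightarrow> nat) \<Rightarrow> (nat \<Rightarrow> nat) \<Rightarrow> nat set" where
  "low g x = {n. x n < g n}"

lemma infinite_low: "infinite (low g x) \<longleftrightarrow> \<not> g \<preceq> x"
  by (simp add: low_def dominated_def cofinite_eq_sequentially[symmetric] eventually_cofinite not_le)

lemma countable_family_bounded:
  fixes X :: "nat \<Rightarrow> nat \<Rightarrow> nat"
  shows "\<exists>h. \<forall>i. X i \<preceq> h"
proof (intro exI allI)
  fix i
  have "X i n \<le> (\<Sum>j\<le>n. X j n)" if "n \<ge> i" for n
    using that member_le_sum[of i "{..n}" "\<lambda>j. X j n"] by simp
  then show "X i \<preceq> (\<lambda>n. \<Sum>j\<le>n. X j n)" by (auto simp: dominated_def eventually_sequentially)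
qed

definition cone :: "nat list set \<Rightarrow> nat list \<Rightarrow> nat list set" where
  "cone P r = {s \<in> P. prefix s r \<or> prefix r s}"

lemma cone_Miller:
  assumes P: "P \<in> Miller" and r: "r \<in> P" shows "cone P r \<in> Miller"
  unfolding Miller_def
proof safe
  show "is_tree (cone P r)" unfolding is_tree_def
  proof safe
    show "s \<in> cone P r" if "t \<in> cone P r" "prefix s t" for s t
      using that treeD[OF MillerD(1)[OF P]] prefix_order.trans prefix_same_cases unfolding cone_def by blast
  qed (use r in \<open>auto simp: cone_def\<close>)
next
  fix s assume s: "s \<in> cone P r"
  define s' where "s' = (if prefix r s then s else r)"
  have "s' \<in> P" "prefix s s'" "prefix r s'" using s r by (auto simp: s'_def cone_def)
  then obtain t where t: "prefix s' t" "inf_split P t" using MillerD(2)[OF P] by blast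
  have "prefix r t" using \<open>prefix r s'\<close> t(1) by (rule prefix_order.trans)
  then have "succs P t \<subseteq> succs (cone P r) t" by (auto simp: succs_def cone_def)
  then have "infinite (succs (cone P r) t)" using t(2) finite_subset by (auto simp: inf_split_def)
  then show "\<exists>t\<in>cone P r. prefix s t \<and> infinite (succs (cone P r) t)"
    using t \<open>prefix r t\<close> \<open>prefix s s'\<close> prefix_order.trans
    by (intro bexI[of _ t]) (auto simp: cone_def inf_split_def)
qed

lemma body_cone_through:
  assumes "x \<in> body (cone P r)" shows "through r x"
proof -
  have "restr x (length r) \<in> cone P r" using assms by (simp add: body_def)
  moreover have "s = r" if "prefix s r \<or> prefix r s" "length s = length r" for s :: "nat list"
    using that by (auto simp: prefix_def)
  ultimately have "restr x (length r) = r" by (simp add: cone_def)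
  then show ?thesis using through_restr[of x "length r"] by simp
qed

lemma Miller_branch:
  assumes P: "P \<in> Miller" and r: "r \<in> P" shows "\<exists>x\<in>body P. through r x"
proof -
  have "body (cone P r) \<noteq> {}" using cone_Miller[OF assms] Miller_subset_Sacks Sacks_body_nonempty by blast
  moreover have "body (cone P r) \<subseteq> body P" by (rule body_mono) (auto simp: cone_def)
  ultimately show ?thesis using body_cone_through by blast
qed

text \<open>
  Fusion of countably many requirements: the node chosen at depth \<open>k\<close> satisfies the
  \<open>k\<close>-th one with some finite set of forbidden successors, and omitting finitely many
  successors is harmless at an infinitely splitting node.
\<close>

lemma Miller_avoid_finite:
  fixes A :: "nat \<Rightarrow> nat list \<Rightarrow> nat set \<Rightarrow> bool"
  assumes P: "P \<in> Miller" and t0: "inf_split P t0"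
    and dense: "\<And>k t. inf_split P t \<Longrightarrow> prefix t0 t \<Longrightarrow>
      \<exists>t' F. prefix t t' \<and> inf_split P t' \<and> finite F \<and> A k t' F"
  shows "\<exists>Q\<in>Miller. Q \<subseteq> P \<and> (\<forall>x\<in>body Q. \<forall>k. \<exists>t F a. A k t F \<and> a \<notin> F \<and> through (t @ [a]) x)"
proof -
  define N where "N k t \<longleftrightarrow> prefix t0 t \<and> inf_split P t \<and> (\<exists>F. finite F \<and> A k t F)" for k :: nat and t
  define E where "E k t l s \<longleftrightarrow> (\<exists>F. A k t F \<and> (\<forall>a. l a \<notin> F))"
    for k :: nat and t and l :: "nat \<Rightarrow> nat" and s :: "nat \<Rightarrow> nat list"
  have reach: "\<exists>t'. prefix t t' \<and> N k t'" if t: "t \<in> P" "prefix t0 t" for k t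
  proof -
    obtain r where r: "prefix t r" "inf_split P r" using MillerD(2)[OF P t(1)] by blast
    have "prefix t0 r" using t(2) r(1) by (rule prefix_order.trans)
    then obtain t' F where "prefix r t'" "inf_split P t'" "finite F" "A k t' F"
      using dense[OF r(2), of k] by blast
    then show ?thesis using r(1) \<open>prefix t0 r\<close> prefix_order.trans unfolding N_def by blast
  qed
  have "t0 \<in> P" using t0 by (simp add: inf_split_def)
  then obtain t1 where base: "N 0 t1" using reach[of t0 0] by auto
  have step: "\<exists>l s. inj l \<and> (\<forall>a. N (Suc k) (s a) \<and> prefix (t @ [l a]) (s a)) \<and> E k t l s" if N: "N k t" for k t
  proof -
    obtain F where F: "finite F" "A k t F" using N by (auto simp: N_def)
    have "infinite (succs P t - F)" using N F(1) by (auto simp: N_def inf_split_def)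
    then obtain l :: "nat \<Rightarrow> nat" where l: "inj l" "range l \<subseteq> succs P t - F"
      using infinite_countable_subset by blast
    have "\<exists>s. prefix (t @ [l a]) s \<and> N (Suc k) s" for a
      using l(2) N by (intro reach) (auto simp: succs_def N_def)
    then obtain s where "\<And>a. prefix (t @ [l a]) (s a) \<and> N (Suc k) (s a)" by metis
    moreover have "E k t l s" using F(2) l(2) by (auto simp: E_def)
    ultimately show ?thesis using l(1) by blast
  qed
  obtain \<tau> l where sch: "scheme \<tau> l" and N\<tau>: "\<And>u. N (length u) (\<tau> u)"
    and E\<tau>: "\<And>u. E (length u) (\<tau> u) (l u) (\<lambda>a. \<tau> (u @ [a]))"
    using scheme_exists[of N t1 E, OF base step] by blast
  have "downset \<tau> UNIV \<subseteq> P"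
    using N\<tau> MillerD(1)[OF P] by (intro downset_subset) (auto simp: N_def inf_split_def)
  moreover have "\<exists>t F a. A k t F \<and> a \<notin> F \<and> through (t @ [a]) x" if x_in: "x \<in> body (downset \<tau> UNIV)" for x k
  proof -
    obtain y where x: "x = point \<tau> y" using downset_branch[OF sch _ x_in] by auto
    obtain F where "A k (\<tau> (initial y k)) F" "\<And>a. l (initial y k) a \<notin> F"
      using E\<tau>[of "initial y k"] by (auto simp: E_def)
    then show ?thesis using through_point[OF sch, of y k] point_label[OF sch, of y k]
      unfolding x by (intro exI[of _ "\<tau> (initial y k)"] exI[of _ F] exI[of _ "l (initial y k) (y k)"]) simp
  qed
  ultimately show ?thesis using full_downset_Miller[OF sch]
    by (intro bexI[of _ "downset \<tau> UNIV"] conjI ballI allI) simp_all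
qed

text \<open>
  Each stage of the fusion adds a further position at which the branch is below \<open>g\<close>.
\<close>

lemma Miller_low_subtree:
  assumes P: "P \<in> Miller" and t0: "inf_split P t0"
    and dense: "\<And>t. inf_split P t \<Longrightarrow> prefix t0 t \<Longrightarrow>
      infinite {a. \<exists>s\<in>P. prefix (t @ [a]) s \<and> (\<exists>n. length t \<le> n \<and> n < length s \<and> s ! n < g n)}"
  shows "\<exists>Q\<in>Miller. Q \<subseteq> P \<and> (\<forall>x\<in>body Q. \<not> g \<preceq> x)"
proof -
  define N where "N k t \<longleftrightarrow> prefix t0 t \<and> inf_split P t" for k :: nat and t
  define E where "E k t l s \<longleftrightarrow> (\<forall>a. \<exists>n. length t \<le> n \<and> n < length (s a) \<and> s a ! n < g n)"
    for k :: nat and t :: "nat list" and l :: "nat \<Rightarrow> nat" and s :: "nat \<Rightarrow> nat list"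
  have base: "N 0 t0" using t0 by (simp add: N_def)
  have step: "\<exists>l s. inj l \<and> (\<forall>a. N (Suc k) (s a) \<and> prefix (t @ [l a]) (s a)) \<and> E k t l s" if N: "N k t" for k t
  proof -
    obtain l :: "nat \<Rightarrow> nat" where l: "inj l"
      "range l \<subseteq> {a. \<exists>s\<in>P. prefix (t @ [a]) s \<and> (\<exists>n. length t \<le> n \<and> n < length s \<and> s ! n < g n)}"
      using infinite_countable_subset[OF dense[of t]] N by (auto simp: N_def)
    have "\<exists>s. N (Suc k) s \<and> prefix (t @ [l a]) s \<and> (\<exists>n. length t \<le> n \<and> n < length s \<and> s ! n < g n)" for a
    proof -
      obtain r n where r: "r \<in> P" "prefix (t @ [l a]) r" "length t \<le> n" "n < length r" "r ! n < g n"
        using l(2) by blast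
      obtain s where s: "prefix r s" "inf_split P s" using MillerD(2)[OF P r(1)] by blast
      have "prefix (t @ [l a]) s" using r(2) s(1) by (rule prefix_order.trans)
      moreover have "prefix t0 s"
        using N calculation by (auto simp: N_def intro: prefix_order.trans[of t0 t s] append_prefixD)
      moreover have "n < length s" "s ! n < g n" using r(4,5) s(1) by (auto simp: prefix_nth)
      ultimately show ?thesis using s(2) r(3) unfolding N_def by blast
    qed
    then obtain s where "\<And>a. N (Suc k) (s a) \<and> prefix (t @ [l a]) (s a) \<and>
        (\<exists>n. length t \<le> n \<and> n < length (s a) \<and> s a ! n < g n)" by metis
    then show ?thesis using l(1) unfolding E_def by blast
  qed
  obtain \<tau> l where sch: "scheme \<tau> l" and N\<tau>: "\<And>u. N (length u) (\<tau> u)"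
    and E\<tau>: "\<And>u. E (length u) (\<tau> u) (l u) (\<lambda>a. \<tau> (u @ [a]))"
    using scheme_exists[of N t0 E, OF base step] by blast
  have "downset \<tau> UNIV \<subseteq> P"
    using N\<tau> MillerD(1)[OF P] by (intro downset_subset) (auto simp: N_def inf_split_def)
  moreover have "\<not> g \<preceq> x" if x_in: "x \<in> body (downset \<tau> UNIV)" for x
  proof -
    obtain y where x: "x = point \<tau> y" using downset_branch[OF sch _ x_in] by auto
    have "\<exists>n\<ge>k. x n < g n" for k
    proof -
      obtain n where n: "length (\<tau> (initial y k)) \<le> n" "n < length (\<tau> (initial y (Suc k)))"
        "\<tau> (initial y (Suc k)) ! n < g n"
        using E\<tau>[of "initial y k"] by (auto simp: E_def initial_Suc)
      moreover have "x n = \<tau> (initial y (Suc k)) ! n"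
        using through_point[OF sch, of y "Suc k"] n(2) by (simp add: x through_def)
      moreover have "k \<le> length (\<tau> (initial y k))" using scheme_length[OF sch, of "initial y k"] by simp
      ultimately show ?thesis by (intro exI[of _ n]) simp
    qed
    then show ?thesis by (auto simp: dominated_def eventually_sequentially not_le)
  qed
  ultimately show ?thesis using full_downset_Miller[OF sch]
    by (intro bexI[of _ "downset \<tau> UNIV"] conjI ballI allI) simp_all
qed

text \<open>
  Sequential compactness of the Cantor space, in the weak form that some \<open>S\<close> is a
  cluster point.
\<close>

lemma cluster_point:
  fixes f :: "nat \<Rightarrow> nat \<Rightarrow> bool"
  assumes A: "infinite A"
  shows "\<exists>S. \<forall>m. infinite {a \<in> A. \<forall>n<m. f a n = S n}"
proof -
  have "\<exists>B. \<forall>m. (infinite (B m) \<and> B m \<subseteq> A) \<and> (B (Suc m) \<subseteq> B m \<and> (\<exists>b. \<forall>a\<in>B (Suc m). f a m = b))"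
  proof (rule dependent_nat_choice)
    show "\<exists>B. infinite B \<and> B \<subseteq> A" using A by blast
  next
    fix B m assume B: "infinite B \<and> B \<subseteq> A"
    have "B = {a \<in> B. f a m} \<union> {a \<in> B. \<not> f a m}" by blast
    then have "infinite {a \<in> B. f a m} \<or> infinite {a \<in> B. \<not> f a m}" using B finite_UnI by metis
    then have "\<exists>b. infinite {a \<in> B. f a m = b}" unfolding ex_bool_eq by auto
    then obtain b where "infinite {a \<in> B. f a m = b}" by (rule exE)
    then show "\<exists>B'. (infinite B' \<and> B' \<subseteq> A) \<and> B' \<subseteq> B \<and> (\<exists>b. \<forall>a\<in>B'. f a m = b)"
      using B by (intro exI[of _ "{a \<in> B. f a m = b}"]) auto
  qed
  then obtain B where "\<forall>m. (infinite (B m) \<and> B m \<subseteq> A) \<and> (B (Suc m) \<subseteq> B m \<and> (\<exists>b. \<forall>a\<in>B (Suc m). f a m = b))"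
    by (rule exE)
  then have B: "infinite (B m)" "B m \<subseteq> A" "B (Suc m) \<subseteq> B m" "\<exists>b. \<forall>a\<in>B (Suc m). f a m = b" for m
    by simp_all
  have "\<forall>m. \<exists>b. \<forall>a\<in>B (Suc m). f a m = b" using B(4) by blast
  from choice[OF this] obtain S where "\<forall>m. \<forall>a\<in>B (Suc m). f a m = S m" by (rule exE)
  then have S: "f a m = S m" if "a \<in> B (Suc m)" for m a using that by blast
  have anti: "B n \<subseteq> B m" if "m \<le> n" for m n
    by (rule lift_Suc_antimono_le[of B, OF B(3) that])
  have "B m \<subseteq> {a \<in> A. \<forall>n<m. f a n = S n}" for m
  proof
    fix a assume a: "a \<in> B m"
    have "f a n = S n" if "n < m" for n using anti[of "Suc n" m] that a S by auto
    then show "a \<in> {a \<in> A. \<forall>n<m. f a n = S n}" using a B(2) by blast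
  qed
  then have "infinite {a \<in> A. \<forall>n<m. f a n = S n}" for m by (rule infinite_super[OF _ B(1)])
  then show ?thesis by blast
qed

text \<open>
  Choose a branch through every successor of \<open>t\<close>, and let \<open>S\<close> be a
  cluster point of their low sets. Since the low set is not constantly \<open>S\<close> on any
  subtree, a branch agreeing with \<open>S\<close> for a while can be changed later so that it
  disagrees with \<open>S\<close>. In this way nodes are found which agree with \<open>S\<close>
  longer and longer before they depart from it; any two of them differ at the point where the
  first one departs.
\<close>

lemma Miller_separated_successors:
  assumes Q: "Q \<in> Miller" and t: "inf_split Q t"
    and nonconst: "\<And>Q' S. Q' \<in> Miller \<Longrightarrow> Q' \<subseteq> Q \<Longrightarrow> \<exists>x\<in>body Q'. low g x \<noteq> S"
  shows "\<exists>l s. inj l \<and> (\<forall>i::nat. inf_split Q (s i) \<and> prefix (t @ [l i]) (s i)) \<and>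
    (\<forall>i j. i \<noteq> j \<longrightarrow> (\<exists>n. n < length (s i) \<and> n < length (s j) \<and> (s i ! n < g n) \<noteq> (s j ! n < g n)))"
proof -
  have "\<forall>a\<in>succs Q t. \<exists>x. x \<in> body Q \<and> through (t @ [a]) x"
    using Miller_branch[OF Q] unfolding succs_def by blast
  from bchoice[OF this] obtain x where x: "\<And>a. a \<in> succs Q t \<Longrightarrow> x a \<in> body Q"
    "\<And>a. a \<in> succs Q t \<Longrightarrow> through (t @ [a]) (x a)" by blast
  have inf: "infinite (succs Q t)" using t by (simp add: inf_split_def)
  obtain S where S: "\<And>m. infinite {a \<in> succs Q t. \<forall>n<m. (x a n < g n) = S n}"
    using cluster_point[OF inf, of "\<lambda>a n. x a n < g n"] by blast
  define N where "N p \<longleftrightarrow> inf_split Q (snd p) \<and> prefix (t @ [fst p]) (snd p) \<and>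
      (\<exists>n<length (snd p). (snd p ! n < g n) \<noteq> S n)" for p
  have next_pair: "\<exists>p. N p \<and> b < fst p \<and> m \<le> length (snd p) \<and> (\<forall>n<m. (snd p ! n < g n) = S n)" for b m
  proof -
    obtain a where a: "a \<in> succs Q t" "b < a" and aS: "\<And>n. n < m \<Longrightarrow> (x a n < g n) = S n"
      using S[of m] unfolding infinite_nat_iff_unbounded by blast
    define r where "r = restr (x a) (max m (Suc (length t)))"
    have r: "r \<in> Q" using x(1)[OF a(1)] by (simp add: r_def body_def)
    have tr: "prefix (t @ [a]) r"
      by (rule through_comparable[OF x(2)[OF a(1)]]) (simp_all add: r_def)
    have "cone Q r \<subseteq> Q" by (auto simp: cone_def)
    then obtain w where w: "w \<in> body (cone Q r)" "low g w \<noteq> {n. S n}"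
      using nonconst[OF cone_Miller[OF Q r]] by blast
    have wr: "through r w" using w(1) by (rule body_cone_through)
    obtain n0 where n0: "(w n0 < g n0) \<noteq> S n0" using w(2) by (auto simp: low_def)
    have "restr w (max (length r) (Suc n0)) \<in> Q"
      using w(1) body_mono[of "cone Q r" Q] by (auto simp: body_def cone_def)
    then obtain s where s: "prefix (restr w (max (length r) (Suc n0))) s" "inf_split Q s"
      using MillerD(2)[OF Q] by blast
    have sw: "s ! n = w n" if "n < max (length r) (Suc n0)" for n
      using s(1) that by (auto simp: prefix_nth)
    have len: "max (length r) (Suc n0) \<le> length s" using prefix_length_le[OF s(1)] by simp
    have "prefix r s"
      using wr sw len by (auto simp: prefix_nth through_def)
    then have "prefix (t @ [a]) s" using tr prefix_order.trans by blast
    moreover have "(s ! n0 < g n0) \<noteq> S n0" "n0 < length s" using n0 sw[of n0] len by auto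
    moreover have "m \<le> length s" using len by (simp add: r_def)
    moreover have "(s ! n < g n) = S n" if "n < m" for n
    proof -
      have "n < length r" using that by (simp add: r_def)
      then have "s ! n = x a n" using sw[of n] wr by (simp add: through_def r_def)
      then show ?thesis using aS[OF that] by simp
    qed
    ultimately show ?thesis using s(2) a(2) by (intro exI[of _ "(a, s)"]) (auto simp: N_def)
  qed
  have "\<exists>p. \<forall>i. N (p i) \<and> (fst (p i) < fst (p (Suc i)) \<and> length (snd (p i)) \<le> length (snd (p (Suc i))) \<and>
      (\<forall>n<length (snd (p i)). (snd (p (Suc i)) ! n < g n) = S n))"
    by (rule dependent_nat_choice) (use next_pair in blast)+
  then obtain p where p: "\<And>i. N (p i)" "\<And>i. fst (p i) < fst (p (Suc i))"
    "\<And>i. length (snd (p i)) \<le> length (snd (p (Suc i)))"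
    "\<And>i n. n < length (snd (p i)) \<Longrightarrow> (snd (p (Suc i)) ! n < g n) = S n" by blast
  have sep: "\<exists>n. n < length (snd (p i)) \<and> n < length (snd (p j)) \<and>
      (snd (p i) ! n < g n) \<noteq> (snd (p j) ! n < g n)" if ij: "i < j" for i j
  proof -
    obtain n where n: "n < length (snd (p i))" "(snd (p i) ! n < g n) \<noteq> S n" using p(1)[of i] by (auto simp: N_def)
    obtain k where k: "j = Suc k" "i \<le> k" using ij by (cases j) auto
    have "length (snd (p i)) \<le> length (snd (p k))"
      using lift_Suc_mono_le[of "\<lambda>i. length (snd (p i))", OF p(3) k(2)] .
    then have "n < length (snd (p k))" using n(1) by simp
    then show ?thesis using n p(3)[of k] p(4)[of n k] by (intro exI[of _ n]) (auto simp: k(1))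
  qed
  have "inj (\<lambda>i. fst (p i))" using p(2) by (simp add: strict_mono_Suc_iff strict_mono_imp_inj_on)
  moreover have "\<exists>n. n < length (snd (p i)) \<and> n < length (snd (p j)) \<and>
      (snd (p i) ! n < g n) \<noteq> (snd (p j) ! n < g n)" if "i \<noteq> j" for i j
    using sep[of i j] sep[of j i] that by (cases "i < j") (auto simp: not_less)
  ultimately show ?thesis using p(1)
    by (intro exI[of _ "\<lambda>i. fst (p i)"] exI[of _ "\<lambda>i. snd (p i)"]) (simp add: N_def)
qed

text \<open>
  If the low set is not constant on any Miller subtree, then at each splitting node infinitely
  many successors can be continued to nodes with incompatible low sets, and fusion makes
  \<open>low g\<close> injective.
\<close>

lemma Miller_low_constant_or_injective:
  assumes Q: "Q \<in> Miller"
  shows "\<exists>Q'\<in>Miller. Q' \<subseteq> Q \<and> ((\<exists>S. \<forall>x\<in>body Q'. low g x = S) \<or> inj_on (low g) (body Q'))"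
proof (cases "\<exists>S. \<exists>Q'\<in>Miller. Q' \<subseteq> Q \<and> (\<forall>x\<in>body Q'. low g x = S)")
  case True
  then obtain S Q' where "Q' \<in> Miller" "Q' \<subseteq> Q" "\<forall>x\<in>body Q'. low g x = S" by (elim exE bexE conjE)
  then show ?thesis by (intro bexI[of _ Q'] conjI disjI1 exI[of _ S])
next
  case False
  have nonconst: "\<exists>x\<in>body Q'. low g x \<noteq> S" if "Q' \<in> Miller" "Q' \<subseteq> Q" for Q' S
  proof (rule ccontr)
    assume "\<not> ?thesis"
    then have "\<forall>x\<in>body Q'. low g x = S" by simp
    with that have "\<exists>S. \<exists>Q'\<in>Miller. Q' \<subseteq> Q \<and> (\<forall>x\<in>body Q'. low g x = S)"
      by (intro exI[of _ S] bexI[of _ Q'] conjI)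
    with False show False by (rule notE)
  qed
  obtain t0 where base: "inf_split Q t0" using MillerD(3)[OF Q] by blast
  define E where "E k t l s \<longleftrightarrow>
    (\<forall>i j. i \<noteq> j \<longrightarrow> (\<exists>n. n < length (s i) \<and> n < length (s j) \<and> (s i ! n < g n) \<noteq> (s j ! n < g n)))"
    for k :: nat and t :: "nat list" and l :: "nat \<Rightarrow> nat" and s :: "nat \<Rightarrow> nat list"
  have step: "\<exists>l s. inj l \<and> (\<forall>a. inf_split Q (s a) \<and> prefix (t @ [l a]) (s a)) \<and> E k t l s"
    if "inf_split Q t" for k t
    unfolding E_def by (rule Miller_separated_successors[OF Q that nonconst])
  obtain \<tau> l where sch: "scheme \<tau> l" and N\<tau>: "\<And>u. inf_split Q (\<tau> u)"
    and E\<tau>: "\<And>u. E (length u) (\<tau> u) (l u) (\<lambda>a. \<tau> (u @ [a]))"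
    using scheme_exists[of "\<lambda>_. inf_split Q" t0 E, OF base step] by blast
  have "downset \<tau> UNIV \<subseteq> Q"
    using N\<tau> MillerD(1)[OF Q] by (intro downset_subset) (auto simp: inf_split_def)
  moreover have "inj_on (low g) (body (downset \<tau> UNIV))"
  proof (rule inj_onI)
    fix x y assume xy: "x \<in> body (downset \<tau> UNIV)" "y \<in> body (downset \<tau> UNIV)" "low g x = low g y"
    obtain p q where p: "x = point \<tau> p" and q: "y = point \<tau> q"
      using downset_branch[OF sch _ xy(1)] downset_branch[OF sch _ xy(2)] by auto
    have "p = q"
    proof (rule ccontr)
      assume "p \<noteq> q"
      then have "\<exists>k. p k \<noteq> q k" by blast
      then obtain k where k: "p k \<noteq> q k" "\<And>m. m < k \<Longrightarrow> p m = q m"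
        using exists_least_iff[of "\<lambda>k. p k \<noteq> q k"] by blast
      have same: "initial p k = initial q k" using k(2) by (intro nth_equalityI) auto
      obtain n where n: "n < length (\<tau> (initial p (Suc k)))" "n < length (\<tau> (initial q (Suc k)))"
        "(\<tau> (initial p (Suc k)) ! n < g n) \<noteq> (\<tau> (initial q (Suc k)) ! n < g n)"
        using E\<tau>[of "initial p k"] k(1) unfolding E_def initial_Suc same by blast
      then have "(x n < g n) \<noteq> (y n < g n)"
        using through_point[OF sch, of p "Suc k"] through_point[OF sch, of q "Suc k"]
        by (simp add: p q through_def)
      with xy(3) show False by (auto simp: low_def)
    qed
    then show "x = y" by (simp add: p q)
  qed
  ultimately show ?thesis using full_downset_Miller[OF sch]
    by (intro bexI[of _ "downset \<tau> UNIV"] conjI disjI2)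
qed

text \<open>
  The index \<open>Suc n\<close> on the left of
  \<open>d \<xi> (Suc n) \<le> g \<xi> n\<close> is what allows a branch at position
  \<open>Suc n\<close> to be above \<open>d \<xi>\<close>, and thus above all earlier
  \<open>g \<eta>\<close>, but below \<open>g \<xi>\<close>, once
  \<open>g \<xi> (Suc n)\<close> is much larger than \<open>g \<xi> n\<close>.
\<close>

locale scale =
  fixes U :: "(nat \<Rightarrow> nat) set" and g d :: "(nat \<Rightarrow> nat) \<Rightarrow> nat \<Rightarrow> nat"
  assumes unbounded: "\<exists>\<xi>\<in>U. \<not> g \<xi> \<preceq> h"
    and mono_g: "\<xi> \<in> U \<Longrightarrow> strict_mono (g \<xi>)"
    and d_le: "\<xi> \<in> U \<Longrightarrow> d \<xi> (Suc n) \<le> g \<xi> n"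
    and bound: "\<xi> \<in> U \<Longrightarrow> \<eta> \<in> underS |U| \<xi> \<Longrightarrow> g \<eta> \<preceq> d \<xi>"

lemma scale_exists: "\<exists>U g d. scale U g d"
proof -
  define unbdd where "unbdd U \<longleftrightarrow> (\<forall>h. \<exists>u\<in>U. \<not> u \<preceq> h)" for U
  have "\<not> (\<lambda>n. Suc (h n)) \<preceq> h" for h by (simp add: dominated_def)
  then have "unbdd UNIV" by (auto simp: unbdd_def)
  then obtain U where U: "unbdd U" "\<And>B. unbdd B \<Longrightarrow> |U| \<le>o |B|"
    using minimal_cardinality[of unbdd] by blast
  define \<Phi> where "\<Phi> f \<xi> p \<longleftrightarrow> strict_mono (fst p) \<and> (\<forall>n. \<xi> n \<le> fst p n) \<and> (\<forall>n. snd p (Suc n) \<le> fst p n) \<and>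
      (\<forall>\<eta>\<in>underS |U| \<xi>. fst (f \<eta>) \<preceq> snd p)"
    for f :: "(nat \<Rightarrow> nat) \<Rightarrow> (nat \<Rightarrow> nat) \<times> (nat \<Rightarrow> nat)" and \<xi> and p :: "(nat \<Rightarrow> nat) \<times> (nat \<Rightarrow> nat)"
  have "\<exists>f. \<forall>\<xi>\<in>U. \<Phi> f \<xi> (f \<xi>)"
  proof (rule card_recursion)
    fix f :: "(nat \<Rightarrow> nat) \<Rightarrow> (nat \<Rightarrow> nat) \<times> (nat \<Rightarrow> nat)" and \<xi>
    assume \<xi>: "\<xi> \<in> U"
    have "\<not> unbdd ((\<lambda>\<eta>. fst (f \<eta>)) ` underS |U| \<xi>)" by (rule small_image_underS[OF U(2) \<xi>])
    then obtain d where d: "\<And>\<eta>. \<eta> \<in> underS |U| \<xi> \<Longrightarrow> fst (f \<eta>) \<preceq> d" by (auto simp: unbdd_def)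
    have "\<Phi> f \<xi> (accumulate (\<lambda>k. \<xi> k + d (Suc k)), d)"
      unfolding \<Phi>_def
    proof (intro conjI allI ballI)
      show "strict_mono (fst (accumulate (\<lambda>k. \<xi> k + d (Suc k)), d))"
        by (simp add: strict_mono_Suc_iff accumulate_def)
      show "\<xi> n \<le> fst (accumulate (\<lambda>k. \<xi> k + d (Suc k)), d) n"
        "snd (accumulate (\<lambda>k. \<xi> k + d (Suc k)), d) (Suc n) \<le> fst (accumulate (\<lambda>k. \<xi> k + d (Suc k)), d) n" for n
        using accumulate_ge(2)[of "\<lambda>k. \<xi> k + d (Suc k)" n] by simp_all
    qed (use d in simp)
    then show "\<exists>p. \<Phi> f \<xi> p" by blast
  qed (auto simp: \<Phi>_def)
  then obtain f where f': "\<forall>\<xi>\<in>U. \<Phi> f \<xi> (f \<xi>)" by (rule exE)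
  have f: "\<Phi> f \<xi> (f \<xi>)" if "\<xi> \<in> U" for \<xi> using f' that by (rule bspec)
  have "scale U (\<lambda>\<xi>. fst (f \<xi>)) (\<lambda>\<xi>. snd (f \<xi>))"
  proof
    fix h
    obtain \<xi> where \<xi>: "\<xi> \<in> U" "\<not> \<xi> \<preceq> h" using U(1) by (auto simp: unbdd_def)
    have "\<xi> \<preceq> fst (f \<xi>)" using f[OF \<xi>(1)] by (auto simp: \<Phi>_def intro: dominated_if_le)
    with \<xi> dominated_trans show "\<exists>\<xi>\<in>U. \<not> fst (f \<xi>) \<preceq> h" by blast
  qed (use f in \<open>auto simp: \<Phi>_def\<close>)
  then show ?thesis by blast
qed

context scale
begin

definition rank :: "(nat \<Rightarrow> nat) \<Rightarrow> (nat \<Rightarrow> nat) \<Rightarrow> bool" where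
  "rank x \<xi> \<longleftrightarrow> \<xi> \<in> U \<and> \<not> g \<xi> \<preceq> x \<and> (\<forall>\<eta>\<in>underS |U| \<xi>. g \<eta> \<preceq> x)"

lemma rank_unique: "rank x \<xi> \<Longrightarrow> rank x \<eta> \<Longrightarrow> \<xi> = \<eta>"
  using card_total[of \<xi> U \<eta>] by (auto simp: rank_def)

lemma d_le_g: "\<xi> \<in> U \<Longrightarrow> n > 0 \<Longrightarrow> d \<xi> n \<le> g \<xi> n"
  using d_le[of \<xi> "n - 1"] strict_mono_less_eq[OF mono_g[of \<xi>], of "n - 1" n] by simp

lemma g_increasing:
  assumes "\<xi> \<in> U" "\<eta> \<in> underS |U| \<xi>" shows "g \<eta> \<preceq> g \<xi>"
proof (rule dominated_trans[OF bound[OF assms]])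
  show "d \<xi> \<preceq> g \<xi>" unfolding dominated_def eventually_sequentially
    using d_le_g[OF assms(1)] by (intro exI[of _ 1]) auto
qed

text \<open>
  Countably many branches, one through each node, are dominated by a single \<open>h\<close>. A
  member of the scale not dominated by \<open>h\<close> exceeds each of these branches infinitely
  often, so every node can be extended to pick up a low position.
\<close>

lemma Miller_low:
  assumes P: "P \<in> Miller"
  shows "\<exists>\<xi>\<in>U. \<exists>Q\<in>Miller. Q \<subseteq> P \<and> (\<forall>x\<in>body Q. \<not> g \<xi> \<preceq> x)"
proof -
  have "\<forall>r\<in>P. \<exists>x. x \<in> body P \<and> through r x" using Miller_branch[OF P] by blast
  from bchoice[OF this] obtain x where x: "\<forall>r\<in>P. x r \<in> body P \<and> through r (x r)" by (rule exE)
  obtain h where h: "\<And>i. x (from_nat i) \<preceq> h"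
    using countable_family_bounded[of "\<lambda>i. x (from_nat i)"] by blast
  obtain \<xi> where \<xi>: "\<xi> \<in> U" "\<not> g \<xi> \<preceq> h" using unbounded by blast
  have freq: "\<not> g \<xi> \<preceq> x r" for r using h[of "to_nat r"] \<xi>(2) dominated_trans by auto
  obtain t0 where t0: "inf_split P t0" using MillerD(3)[OF P] by blast
  have "\<exists>Q\<in>Miller. Q \<subseteq> P \<and> (\<forall>x\<in>body Q. \<not> g \<xi> \<preceq> x)"
  proof (rule Miller_low_subtree[OF P t0])
    fix t assume t: "inf_split P t"
    have "succs P t \<subseteq> {a. \<exists>s\<in>P. prefix (t @ [a]) s \<and> (\<exists>n. length t \<le> n \<and> n < length s \<and> s ! n < g \<xi> n)}"
    proof safe
      fix a assume a: "a \<in> succs P t"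
      define z where "z = x (t @ [a])"
      have z: "z \<in> body P" "through (t @ [a]) z" using x a by (auto simp: z_def succs_def)
      obtain n where n: "n \<ge> length t" "z n < g \<xi> n"
        using freq[of "t @ [a]"] by (auto simp: z_def dominated_def eventually_sequentially not_le)
      have "restr z (Suc n) \<in> P" using z(1) by (simp add: body_def)
      moreover have "prefix (t @ [a]) (restr z (Suc n))" using n(1) by (intro through_comparable[OF z(2)]) auto
      ultimately show "\<exists>s\<in>P. prefix (t @ [a]) s \<and> (\<exists>n. length t \<le> n \<and> n < length s \<and> s ! n < g \<xi> n)"
        using n by (intro bexI[of _ "restr z (Suc n)"] conjI exI[of _ n]) auto
    qed
    then show "infinite {a. \<exists>s\<in>P. prefix (t @ [a]) s \<and> (\<exists>n. length t \<le> n \<and> n < length s \<and> s ! n < g \<xi> n)}"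
      using t finite_subset unfolding inf_split_def by blast
  qed
  with \<xi>(1) show ?thesis by blast
qed

text \<open>
  Let \<open>\<xi>\<close> be least such that some Miller subtree \<open>Q\<close> of
  \<open>P\<close> has no branch dominating \<open>g \<xi>\<close>. For \<open>\<eta>\<close>
  before \<open>\<xi>\<close>, leastness means that the construction of such a subtree for
  \<open>g \<eta>\<close> gets stuck above every node: above some splitting node
  \<open>t\<close>, all but finitely many successors force the branch to be above
  \<open>g \<eta>\<close> from \<open>length t\<close> on (\<open>good \<eta> t F\<close>).
  It remains to fuse these subtrees for all \<open>\<eta>\<close> before \<open>\<xi>\<close>,
  which may be uncountably many, while fusion handles only countably many requirements. There are
  only countably many pairs \<open>(t, F)\<close>, however. Either pairs that are good for
  cofinally many \<open>\<eta>\<close> occur above every node, and then a single requirement is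
  enough; or above some node \<open>t0\<close> each pair is good only for a bounded set of
  indices, and then countably many bounds are cofinal among the \<open>g \<eta>\<close>.
\<close>

lemma Miller_constant_rank:
  assumes P: "P \<in> Miller"
  shows "\<exists>\<xi>. \<exists>Q\<in>Miller. Q \<subseteq> P \<and> (\<forall>x\<in>body Q. rank x \<xi>)"
proof -
  define \<Phi> where "\<Phi> \<xi> \<longleftrightarrow> (\<exists>Q\<in>Miller. Q \<subseteq> P \<and> (\<forall>x\<in>body Q. \<not> g \<xi> \<preceq> x))" for \<xi>
  obtain \<xi>0 where "\<xi>0 \<in> U" "\<Phi> \<xi>0" using Miller_low[OF P] by (auto simp: \<Phi>_def)
  then obtain \<xi> where \<xi>: "\<xi> \<in> U" "\<Phi> \<xi>" and least: "\<And>\<eta>. \<eta> \<in> underS |U| \<xi> \<Longrightarrow> \<not> \<Phi> \<eta>"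
    by (rule card_least[of _ U \<Phi>]) (rule that)
  obtain Q where Q: "Q \<in> Miller" "Q \<subseteq> P" "\<And>x. x \<in> body Q \<Longrightarrow> \<not> g \<xi> \<preceq> x" using \<xi>(2) by (auto simp: \<Phi>_def)
  define good where "good \<eta> t F \<longleftrightarrow> (\<forall>a s n. a \<notin> F \<longrightarrow> s \<in> Q \<longrightarrow> prefix (t @ [a]) s \<longrightarrow>
      length t \<le> n \<longrightarrow> n < length s \<longrightarrow> g \<eta> n \<le> s ! n)" for \<eta> t F
  have dense: "\<exists>t' F. prefix t t' \<and> inf_split Q t' \<and> finite F \<and> good \<eta> t' F"
    if \<eta>: "\<eta> \<in> underS |U| \<xi>" and t: "inf_split Q t" for \<eta> t
  proof (rule ccontr)
    assume none: "\<not> ?thesis"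
    have "\<exists>Q'\<in>Miller. Q' \<subseteq> Q \<and> (\<forall>x\<in>body Q'. \<not> g \<eta> \<preceq> x)"
    proof (rule Miller_low_subtree[OF Q(1) t])
      fix t' assume t': "inf_split Q t'" "prefix t t'"
      define F where "F = {a. \<exists>s\<in>Q. prefix (t' @ [a]) s \<and> (\<exists>n. length t' \<le> n \<and> n < length s \<and> s ! n < g \<eta> n)}"
      have "good \<eta> t' F" unfolding good_def F_def by (auto simp: not_less[symmetric])
      then show "infinite F" using none t' by blast
    qed
    then have "\<Phi> \<eta>" using Q(2) unfolding \<Phi>_def by blast
    with least[OF \<eta>] show False by blast
  qed
  have good: "g \<eta> \<preceq> x" if "good \<eta> t F" "a \<notin> F" "through (t @ [a]) x" "x \<in> body Q" for \<eta> t F a x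
    unfolding dominated_def eventually_sequentially
  proof (intro exI[of _ "length t"] allI impI)
    fix n assume n: "length t \<le> n"
    have "prefix (t @ [a]) (restr x (Suc n))" using n by (intro through_comparable[OF that(3)]) auto
    moreover have "restr x (Suc n) \<in> Q" using that(4) by (simp add: body_def)
    ultimately have "g \<eta> n \<le> restr x (Suc n) ! n"
      using n by (intro that(1)[unfolded good_def, rule_format, OF that(2)]) auto
    then show "g \<eta> n \<le> x n" by simp
  qed
  have inU: "\<eta> \<in> U" if "\<eta> \<in> underS |U| \<xi>" for \<eta> using that by (rule underS_card_subset)
  have "\<exists>Q'\<in>Miller. Q' \<subseteq> Q \<and> (\<forall>x\<in>body Q'. \<forall>\<eta>\<in>underS |U| \<xi>. g \<eta> \<preceq> x)"
  proof (cases "underS |U| \<xi> = {}")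
    case True
    then show ?thesis using Q(1) by blast
  next
    case False
    define cofinal where "cofinal t F \<longleftrightarrow>
      (\<forall>\<eta>\<in>underS |U| \<xi>. \<exists>\<eta>'\<in>underS |U| \<xi>. g \<eta> \<preceq> g \<eta>' \<and> good \<eta>' t F)" for t F
    show ?thesis
    proof (cases "\<exists>t0. inf_split Q t0 \<and>
        (\<forall>t F. prefix t0 t \<longrightarrow> inf_split Q t \<longrightarrow> finite F \<longrightarrow> \<not> cofinal t F)")
      case False
      obtain t0 where t0: "inf_split Q t0" using MillerD(3)[OF Q(1)] by blast
      have "\<exists>Q'\<in>Miller. Q' \<subseteq> Q \<and> (\<forall>x\<in>body Q'. \<forall>k::nat. \<exists>t F a. cofinal t F \<and> a \<notin> F \<and> through (t @ [a]) x)"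
        by (rule Miller_avoid_finite[OF Q(1) t0]) (use False in blast)
      then obtain Q' where Q': "Q' \<in> Miller" "Q' \<subseteq> Q"
        "\<And>x. x \<in> body Q' \<Longrightarrow> \<exists>t F a. cofinal t F \<and> a \<notin> F \<and> through (t @ [a]) x" by blast
      have "g \<eta> \<preceq> x" if x: "x \<in> body Q'" and \<eta>: "\<eta> \<in> underS |U| \<xi>" for x \<eta>
      proof -
        obtain t F a where t: "cofinal t F" "a \<notin> F" "through (t @ [a]) x" using Q'(3)[OF x] by blast
        obtain \<eta>' where \<eta>': "g \<eta> \<preceq> g \<eta>'" "good \<eta>' t F" using t(1) \<eta> by (auto simp: cofinal_def)
        have "g \<eta>' \<preceq> x" using good[OF \<eta>'(2) t(2,3)] x body_mono[OF Q'(2)] by blast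
        with \<eta>'(1) show ?thesis by (rule dominated_trans)
      qed
      with Q' show ?thesis by (intro bexI[of _ Q'] conjI ballI) simp_all
    next
      case True
      then obtain t0 where t0: "inf_split Q t0"
        and never: "\<And>t F. prefix t0 t \<Longrightarrow> inf_split Q t \<Longrightarrow> finite F \<Longrightarrow> \<not> cofinal t F" by blast
      obtain \<eta>0 where \<eta>0: "\<eta>0 \<in> underS |U| \<xi>" using False by blast
      \<comment> \<open>\<open>stop p \<zeta>\<close>: \<open>\<zeta>\<close> bounds the indices
      for which the pair \<open>p\<close> is good; finite sets are coded by lists so that there
      are countably many pairs.\<close>
      define stop where "stop p \<zeta> \<longleftrightarrow> \<zeta> \<in> underS |U| \<xi> \<and> (prefix t0 (fst p) \<and> inf_split Q (fst p) \<longrightarrow>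
          (\<forall>\<eta>\<in>underS |U| \<xi>. g \<zeta> \<preceq> g \<eta> \<longrightarrow> \<not> good \<eta> (fst p) (set (snd p))))"
        for p :: "nat list \<times> nat list" and \<zeta>
      have "\<forall>p. \<exists>\<zeta>. stop p \<zeta>"
      proof
        fix p
        show "\<exists>\<zeta>. stop p \<zeta>"
        proof (cases "prefix t0 (fst p) \<and> inf_split Q (fst p)")
          case True
          then have "\<not> cofinal (fst p) (set (snd p))" by (intro never) auto
          then show ?thesis unfolding cofinal_def stop_def by blast
        next
          case False
          then show ?thesis using \<eta>0 unfolding stop_def by blast
        qed
      qed
      from choice[OF this] obtain \<zeta> where \<zeta>: "\<forall>p. stop p (\<zeta> p)" by (rule exE)
      have "\<exists>Q'\<in>Miller. Q' \<subseteq> Q \<and> (\<forall>x\<in>body Q'. \<forall>k::nat. \<exists>t F a.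
          good (\<zeta> (from_nat k)) t F \<and> a \<notin> F \<and> through (t @ [a]) x)"
      proof (rule Miller_avoid_finite[OF Q(1) t0])
        show "\<exists>t' F. prefix t t' \<and> inf_split Q t' \<and> finite F \<and> good (\<zeta> (from_nat k)) t' F"
          if "inf_split Q t" for k t
          using dense[OF _ that] \<zeta> unfolding stop_def by blast
      qed
      then obtain Q' where Q': "Q' \<in> Miller" "Q' \<subseteq> Q"
        "\<And>x k. x \<in> body Q' \<Longrightarrow> \<exists>t F a. good (\<zeta> (from_nat k)) t F \<and> a \<notin> F \<and> through (t @ [a]) x" by blast
      have below: "g (\<zeta> p) \<preceq> x" if x: "x \<in> body Q'" for x p
        using Q'(3)[OF x, of "to_nat p"] good x body_mono[OF Q'(2)] by auto
      have "g \<eta> \<preceq> x" if x: "x \<in> body Q'" and \<eta>: "\<eta> \<in> underS |U| \<xi>" for x \<eta>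
      proof -
        obtain t F where t: "prefix t0 t" "inf_split Q t" "finite F" "good \<eta> t F"
          using dense[OF \<eta> t0] by blast
        obtain L where L: "set L = F" using finite_list[OF t(3)] by blast
        have z: "\<zeta> (t, L) \<in> underS |U| \<xi>" "\<not> g (\<zeta> (t, L)) \<preceq> g \<eta>"
          using \<zeta>[rule_format, of "(t, L)"] t \<eta> L unfolding stop_def by auto
        have "g \<eta> \<preceq> g \<eta>" by (rule dominated_if_le) simp
        then have "\<eta> \<noteq> \<zeta> (t, L)" "\<zeta> (t, L) \<notin> underS |U| \<eta>"
          using z(2) g_increasing[OF inU[OF \<eta>]] by auto
        then have "\<eta> \<in> underS |U| (\<zeta> (t, L))" using card_total[OF inU[OF \<eta>] inU[OF z(1)]] by blast
        then have "g \<eta> \<preceq> g (\<zeta> (t, L))" by (rule g_increasing[OF inU[OF z(1)]])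
        then show ?thesis using below[OF x] by (rule dominated_trans)
      qed
      with Q' show ?thesis by (intro bexI[of _ Q'] conjI ballI) simp_all
    qed
  qed
  then obtain Q' where Q': "Q' \<in> Miller" "Q' \<subseteq> Q" "\<And>x. x \<in> body Q' \<Longrightarrow> \<forall>\<eta>\<in>underS |U| \<xi>. g \<eta> \<preceq> x" by blast
  have "rank x \<xi>" if x: "x \<in> body Q'" for x
  proof -
    have "x \<in> body Q" using x body_mono[OF Q'(2)] by blast
    then show ?thesis using Q'(3)[OF x] Q(3)[of x] \<xi>(1) by (simp add: rank_def)
  qed
  moreover have "Q' \<subseteq> P" using Q'(2) Q(2) by (rule subset_trans)
  ultimately show ?thesis using Q'(1) by (intro exI[of _ \<xi>] bexI[of _ Q'] conjI ballI)
qed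

text \<open>
  Fix for every node above the stem and every lower bound \<open>v\<close> two successors of size
  at least \<open>v\<close>, and let \<open>F\<close> majorize them. A branch that uses only these
  successors, with lower bounds at most \<open>g \<xi> m\<close> for all positions up to
  \<open>Suc m\<close>, has at \<open>Suc m\<close> a value bounded by an iterate of
  \<open>F\<close> at \<open>g \<xi> m\<close>. Some \<open>g \<xi>\<close> grows faster than
  this from \<open>m\<close> to \<open>Suc m\<close> for infinitely many \<open>m\<close>, and
  \<open>Z\<close> consists of these \<open>Suc m\<close>. At the positions in
  \<open>S \<subseteq> Z\<close> the lower bound is \<open>d \<xi>\<close>, and the branch
  stays below \<open>g \<xi>\<close>; at the others it is \<open>g \<xi>\<close>. Up to the stem
  there is no freedom, which accounts for \<open>s\<close>. The second successor makes the set of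
  branches large.
\<close>

lemma Laver_realizes_low_sets:
  assumes T: "T \<in> Laver"
  shows "\<exists>\<xi>\<in>U. \<exists>s Z. infinite Z \<and> s \<inter> Z = {} \<and> (\<forall>S\<subseteq>Z.
    continuum \<le>o |{x \<in> body T. (\<forall>\<eta>\<in>underS |U| \<xi>. g \<eta> \<preceq> x) \<and> low (g \<xi>) x = s \<union> S}| )"
proof -
  obtain \<tau>0 where tree: "is_tree T" and \<tau>0: "\<tau>0 \<in> T"
    and inf: "\<And>t. t \<in> T \<Longrightarrow> prefix \<tau>0 t \<Longrightarrow> infinite (succs T t)"
    using T by (auto simp: Laver_def is_stem_def)
  have "\<exists>e::bool \<Rightarrow> nat. t \<in> T \<and> prefix \<tau>0 t \<longrightarrow> inj e \<and> (\<forall>b. e b \<in> succs T t \<and> v \<le> e b)" for t v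
  proof (cases "t \<in> T \<and> prefix \<tau>0 t")
    case True
    then obtain a where a: "a \<in> succs T t" "v \<le> a"
      using inf unfolding infinite_nat_iff_unbounded_le by blast
    obtain a' where "a' \<in> succs T t" "a < a'"
      using True inf unfolding infinite_nat_iff_unbounded by blast
    with a show ?thesis by (intro exI[of _ "\<lambda>b. if b then a else a'"]) (auto simp: inj_def)
  qed blast
  then obtain e :: "nat list \<Rightarrow> nat \<Rightarrow> bool \<Rightarrow> nat" where
    e: "\<And>t v. t \<in> T \<Longrightarrow> prefix \<tau>0 t \<Longrightarrow> inj (e t v)"
      "\<And>t v b. t \<in> T \<Longrightarrow> prefix \<tau>0 t \<Longrightarrow> e t v b \<in> succs T t"
      "\<And>t v b. t \<in> T \<Longrightarrow> prefix \<tau>0 t \<Longrightarrow> v \<le> e t v b" by metis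
  define F0 where "F0 v = (\<Sum>p\<in>{..v} \<times> {t. below t v}. e (snd p) (fst p) True + e (snd p) (fst p) False)" for v
  define F where "F v = Suc (accumulate F0 v)" for v
  have F_e: "e t w b \<le> F v" if "w \<le> v" "below t v" for t w v b
  proof -
    have "e t w True + e t w False \<le> F0 v"
      unfolding F0_def using that finite_below
        member_le_sum[of "(w, t)" "{..v} \<times> {t. below t v}" "\<lambda>p. e (snd p) (fst p) True + e (snd p) (fst p) False"]
      by auto
    then show ?thesis using accumulate_ge(2)[of F0 v] by (cases b) (auto simp: F_def)
  qed
  have F_gt: "v < F v" for v using accumulate_ge(1)[of v F0] by (simp add: F_def)
  have F_add: "(F ^^ k) v \<le> (F ^^ (j + k)) v" for j k v
    by (induction j) (auto intro: order_trans less_imp_le[OF F_gt])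
  have F_iter: "(F ^^ k) v \<le> (F ^^ m) v" if "k \<le> m" for k m v
    using F_add[of k v "m - k"] that by simp
  define h where "h v = (F ^^ (v + 2)) v" for v
  obtain G where G: "\<And>c. \<not> c \<preceq> G \<Longrightarrow> \<exists>\<^sub>F n in sequentially. h (c n) < c (Suc n)"
    using escape_bound[of h] by blast
  obtain \<xi> where \<xi>: "\<xi> \<in> U" "\<not> g \<xi> \<preceq> G" using unbounded by blast
  define c where "c = g \<xi>"
  have c_mono: "c m \<le> c n" if "m \<le> n" for m n
    using that strict_mono_less_eq[OF mono_g[OF \<xi>(1)]] by (simp add: c_def)
  have c_ge: "n \<le> c n" for n using mono_g[OF \<xi>(1)] unfolding c_def by (rule strict_mono_imp_increasing)
  obtain v0 where v0: "below \<tau>0 v0" using ex_below by blast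
  define s where "s = {n. n < length \<tau>0 \<and> \<tau>0 ! n < c n}"
  define Z where "Z = {n. \<exists>m. n = Suc m \<and> v0 \<le> m \<and> length \<tau>0 \<le> m \<and> h (c m) < c (Suc m)}"
  have "infinite Z" unfolding infinite_nat_iff_unbounded_le
  proof
    fix N
    have "\<exists>\<^sub>F n in sequentially. h (c n) < c (Suc n)" using G[OF \<xi>(2)] by (simp add: c_def)
    then obtain m where "m \<ge> N + v0 + length \<tau>0" "h (c m) < c (Suc m)"
      by (auto simp: frequently_sequentially)
    then show "\<exists>n\<ge>N. n \<in> Z" by (intro exI[of _ "Suc m"]) (auto simp: Z_def)
  qed
  moreover have "s \<inter> Z = {}" by (auto simp: s_def Z_def)
  moreover have "continuum \<le>o |{x \<in> body T. (\<forall>\<eta>\<in>underS |U| \<xi>. g \<eta> \<preceq> x) \<and> low (g \<xi>) x = s \<union> S}|"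
    if S: "S \<subseteq> Z" for S
  proof -
    define target where "target n = (if n \<in> S then d \<xi> n else c n)" for n
    have S_Suc: "\<exists>m. n = Suc m \<and> v0 \<le> m \<and> length \<tau>0 \<le> m \<and> h (c m) < c (Suc m)" if "n \<in> S" for n
      using that S by (auto simp: Z_def)
    have target_le: "target n \<le> c n" for n
      using d_le_g[OF \<xi>(1), of n] S_Suc[of n] by (auto simp: target_def c_def)
    \<comment> \<open>The bound in terms of \<open>F\<close> is required for all \<open>v\<close>
    at once, because it is used with \<open>v = c m\<close> for the current \<open>m\<close>
    only, and \<open>v\<close> has to be the same throughout the induction that proves it.\<close>
    define N where "N k t \<longleftrightarrow> t \<in> T \<and> prefix \<tau>0 t \<and> length t = length \<tau>0 + k \<and>
      (\<forall>v. v0 \<le> v \<longrightarrow> (\<forall>m<length t. c m \<le> v) \<longrightarrow> below t ((F ^^ length t) v)) \<and>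
      (\<forall>i. length \<tau>0 \<le> i \<longrightarrow> i < length t \<longrightarrow> target i \<le> t ! i \<and> (i \<in> S \<longrightarrow> t ! i < c i))" for k t
    have base: "N 0 \<tau>0" using \<tau>0 v0 F_iter[of 0] below_mono
      by (auto simp: N_def intro: below_mono[OF v0] order_trans)
    have step: "\<exists>l s. inj l \<and> (\<forall>b::bool. N (Suc k) (s b) \<and> prefix (t @ [l b]) (s b)) \<and> True" if N: "N k t" for k t
    proof -
      define n where "n = length t"
      define l where "l = e t (target n)"
      have t: "t \<in> T" "prefix \<tau>0 t" "length t = length \<tau>0 + k" using N by (auto simp: N_def)
      have bt: "below t ((F ^^ n) v)" if "v0 \<le> v" "\<forall>m<n. c m \<le> v" for v
        using N that unfolding N_def n_def by blast
      have lb: "l b \<le> (F ^^ Suc n) v" if "v0 \<le> v" "\<forall>m<n. c m \<le> v" "target n \<le> v" for v b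
        using F_e[OF _ bt[OF that(1,2)], of "target n" b] that(3) F_iter[of 0 n v] by (simp add: l_def)
      have "N (Suc k) (t @ [l b])" for b
        unfolding N_def
      proof (intro conjI allI impI)
        show "t @ [l b] \<in> T" using e(2)[OF t(1,2), of "target n" b] by (simp add: l_def succs_def)
        show "prefix \<tau>0 (t @ [l b])" using t(2) by (simp add: prefix_prefix)
        show "length (t @ [l b]) = length \<tau>0 + Suc k" using t(3) by simp
      next
        fix v assume v: "v0 \<le> v" "\<forall>m<length (t @ [l b]). c m \<le> v"
        have "target n \<le> v" using v(2) target_le[of n] order_trans by (force simp: n_def)
        then have "l b \<le> (F ^^ Suc n) v" using v by (intro lb) (auto simp: n_def)
        moreover have "below t ((F ^^ n) v)" using v by (intro bt) (auto simp: n_def)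
        ultimately show "below (t @ [l b]) ((F ^^ length (t @ [l b])) v)"
          using F_gt[of "(F ^^ n) v"] by (auto simp: below_def n_def)
      next
        fix i assume i: "length \<tau>0 \<le> i" "i < length (t @ [l b])"
        have "target n \<le> l b" using e(3)[OF t(1,2)] by (simp add: l_def)
        then show "target i \<le> (t @ [l b]) ! i" using N i by (auto simp: N_def nth_append n_def less_Suc_eq)
        assume "i \<in> S"
        show "(t @ [l b]) ! i < c i"
        proof (cases "i < length t")
          case True
          then show ?thesis using N i(1) \<open>i \<in> S\<close> by (auto simp: N_def nth_append)
        next
          case False
          then have i_n: "i = n" using i(2) by (simp add: n_def)
          obtain m where m: "n = Suc m" "v0 \<le> m" "h (c m) < c (Suc m)" using S_Suc[OF \<open>i \<in> S\<close>] i_n by auto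
          have "l b \<le> (F ^^ Suc n) (c m)"
          proof (rule lb)
            show "v0 \<le> c m" using m(2) c_ge[of m] by simp
            show "\<forall>j<n. c j \<le> c m" using m(1) c_mono by simp
            show "target n \<le> c m" using \<open>i \<in> S\<close> i_n m(1) d_le[OF \<xi>(1), of m] by (simp add: target_def c_def)
          qed
          also have "\<dots> \<le> h (c m)" unfolding h_def using m(1) c_ge[of m] by (intro F_iter) simp
          also have "\<dots> < c n" using m by simp
          finally show ?thesis using i_n by (simp add: nth_append n_def)
        qed
      qed
      moreover have "inj l" unfolding l_def using e(1)[OF t(1,2)] .
      ultimately show ?thesis by (intro exI[of _ l] exI[of _ "\<lambda>b. t @ [l b]"]) simp
    qed
    obtain \<tau> l where sch: "scheme \<tau> (l :: bool list \<Rightarrow> bool \<Rightarrow> nat)" and N\<tau>: "\<And>u. N (length u) (\<tau> u)"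
      using scheme_exists[of N \<tau>0 "\<lambda>_ _ _ _. True", OF base step] by blast
    have "downset \<tau> UNIV \<subseteq> T" using N\<tau> tree by (intro downset_subset) (auto simp: N_def)
    then have in_T: "point \<tau> y \<in> body T" for y using point_in_downset[OF sch, of y UNIV] body_mono by blast
    have x_stem: "point \<tau> y n = \<tau>0 ! n" if "n < length \<tau>0" for y n
    proof -
      have "through \<tau>0 (point \<tau> y)"
        using N\<tau>[of "initial y 0"] through_point[OF sch, of y 0] through_prefix by (auto simp: N_def)
      then show ?thesis using that by (simp add: through_def)
    qed
    have x_above: "target n \<le> point \<tau> y n \<and> (n \<in> S \<longrightarrow> point \<tau> y n < c n)" if n: "length \<tau>0 \<le> n" for y n
    proof -
      have len: "n < length (\<tau> (initial y (Suc n)))" using N\<tau>[of "initial y (Suc n)"] by (simp add: N_def)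
      then have "point \<tau> y n = \<tau> (initial y (Suc n)) ! n"
        using through_point[OF sch, of y "Suc n"] by (simp add: through_def)
      then show ?thesis using N\<tau>[of "initial y (Suc n)"] n len by (simp add: N_def)
    qed
    have "low (g \<xi>) (point \<tau> y) = s \<union> S" for y
    proof (rule set_eqI)
      fix n
      show "n \<in> low (g \<xi>) (point \<tau> y) \<longleftrightarrow> n \<in> s \<union> S"
      proof (cases "n < length \<tau>0")
        case True
        then have "n \<notin> S" using S_Suc[of n] by auto
        then show ?thesis using True x_stem[OF True] by (simp add: low_def s_def c_def)
      next
        case False
        then show ?thesis using x_above[of n y]
          by (auto simp: low_def s_def c_def target_def split: if_splits)
      qed
    qed
    moreover have "g \<eta> \<preceq> point \<tau> y" if \<eta>: "\<eta> \<in> underS |U| \<xi>" for \<eta> y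
    proof -
      have "\<forall>\<^sub>F n in sequentially. g \<eta> n \<le> d \<xi> n" "\<forall>\<^sub>F n in sequentially. g \<eta> n \<le> g \<xi> n"
        using bound[OF \<xi>(1) \<eta>] g_increasing[OF \<xi>(1) \<eta>] by (auto simp: dominated_def)
      moreover have "\<forall>\<^sub>F n in sequentially. target n \<le> point \<tau> y n"
        using x_above by (auto simp: eventually_sequentially)
      ultimately show ?thesis unfolding dominated_def
        by eventually_elim (auto simp: target_def c_def split: if_splits)
    qed
    moreover have "inj (point \<tau>)" by (rule injI) (rule point_inj[OF sch])
    ultimately show ?thesis using in_T by (intro continuum_ordLeq[of "point \<tau>"]) auto
  qed
  ultimately show ?thesis using \<xi>(1) by blast
qed

end

text \<open>
  The piece of \<open>T\<close> consists of the branches of a rank \<open>\<xi>\<close> with low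
  set \<open>\<sigma> T\<close>. Both depend on \<open>T\<close> only, and
  \<open>\<sigma>\<close> is injective, hence the pieces are disjoint.
\<close>

lemma Laver_Bernstein_Miller_null: "\<exists>B. bernstein Laver B \<and> B \<in> tree_null Miller"
proof -
  obtain U g d where "scale U g d" using scale_exists by blast
  then interpret scale U g d .
  define piece where "piece T \<xi> S = {x \<in> body T. (\<forall>\<eta>\<in>underS |U| \<xi>. g \<eta> \<preceq> x) \<and> low (g \<xi>) x = S}" for T \<xi> S
  define spec where "spec T p \<longleftrightarrow> fst p \<in> U \<and> continuum \<le>o |snd p| \<and>
      (\<forall>S\<in>snd p. infinite S \<and> continuum \<le>o |piece T (fst p) S| )" for T and p :: "(nat \<Rightarrow> nat) \<times> nat set set"
  have "\<exists>p. spec T p" if T: "T \<in> Laver" for T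
  proof -
    obtain \<xi> s Z where \<xi>: "\<xi> \<in> U" and Z: "infinite Z" "s \<inter> Z = {}"
      and S: "\<And>S. S \<subseteq> Z \<Longrightarrow> continuum \<le>o |piece T \<xi> (s \<union> S)|"
      using Laver_realizes_low_sets[OF T] unfolding piece_def by blast
    have "spec T (\<xi>, {s \<union> S | S. S \<subseteq> Z \<and> infinite S})"
      using \<xi> many_subsets[OF Z] S by (auto simp: spec_def)
    then show ?thesis by blast
  qed
  then have "\<forall>T\<in>Laver. \<exists>p. spec T p" by blast
  from bchoice[OF this] obtain p where p: "\<forall>T\<in>Laver. spec T (p T)" by (rule exE)
  then have "continuum \<le>o |snd (p T)|" if "T \<in> Laver" for T using that by (auto simp: spec_def)
  from injective_selection[of Laver "\<lambda>T. snd (p T)", OF this]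
  obtain \<sigma> where \<sigma>: "\<And>T. T \<in> Laver \<Longrightarrow> \<sigma> T \<in> snd (p T)" "inj_on \<sigma> Laver" by blast
  define R where "R T = piece T (fst (p T)) (\<sigma> T)" for T
  have R_rank: "rank x (fst (p T))" and R_low: "low (g (fst (p T))) x = \<sigma> T"
    if "T \<in> Laver" "x \<in> R T" for T x
  proof -
    have "infinite (\<sigma> T)" using p \<sigma>(1)[OF that(1)] that(1) by (auto simp: spec_def)
    with that p show "rank x (fst (p T))" "low (g (fst (p T))) x = \<sigma> T"
      by (auto simp: R_def piece_def rank_def spec_def simp flip: infinite_low)
  qed
  show ?thesis
  proof (rule bernstein_from_disjoint_pieces[where R=R])
    fix T assume T: "T \<in> Laver"
    show "R T \<subseteq> body T" by (auto simp: R_def piece_def)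
    show "continuum \<le>o |R T|" using p \<sigma>(1)[OF T] T by (auto simp: R_def spec_def)
  next
    fix T T' assume T: "T \<in> Laver" "T' \<in> Laver" "T \<noteq> T'"
    show "R T \<inter> R T' = {}"
    proof (rule ccontr)
      assume "R T \<inter> R T' \<noteq> {}"
      then obtain x where x: "x \<in> R T" "x \<in> R T'" by blast
      have "fst (p T) = fst (p T')" using R_rank[OF T(1) x(1)] R_rank[OF T(2) x(2)] by (rule rank_unique)
      then have "\<sigma> T = \<sigma> T'" using R_low[OF T(1) x(1)] R_low[OF T(2) x(2)] by simp
      with \<sigma>(2) T show False by (auto dest: inj_onD)
    qed
  next
    fix P assume P: "P \<in> Miller"
    obtain \<xi> Q1 where Q1: "Q1 \<in> Miller" "Q1 \<subseteq> P" "\<And>x. x \<in> body Q1 \<Longrightarrow> rank x \<xi>"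
      using Miller_constant_rank[OF P] by blast
    obtain Q where Q: "Q \<in> Miller" "Q \<subseteq> Q1"
      and alt: "(\<exists>S. \<forall>x\<in>body Q. low (g \<xi>) x = S) \<or> inj_on (low (g \<xi>)) (body Q)"
      using Miller_low_constant_or_injective[OF Q1(1), of "g \<xi>"] by (elim bexE conjE)
    have low_Q: "low (g \<xi>) x = \<sigma> T" if "T \<in> Laver" "x \<in> body Q \<inter> R T" for x T
    proof -
      have "rank x \<xi>" using that(2) Q1(3) body_mono[OF Q(2)] by blast
      then have "fst (p T) = \<xi>" using R_rank[OF that(1)] that(2) rank_unique by blast
      then show ?thesis using R_low[OF that(1)] that(2) by blast
    qed
    have "\<exists>T0. \<forall>T\<in>Laver. T \<noteq> T0 \<longrightarrow> countable (body Q \<inter> R T)"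
      using alt
    proof
      assume "inj_on (low (g \<xi>)) (body Q)"
      then have "x = y" if "T \<in> Laver" "x \<in> body Q \<inter> R T" "y \<in> body Q \<inter> R T" for T x y
        using low_Q[OF that(1,2)] low_Q[OF that(1,3)] that by (auto dest: inj_onD)
      then have "body Q \<inter> R T = {} \<or> (\<exists>x. body Q \<inter> R T = {x})" if "T \<in> Laver" for T
        using that by blast
      then have "countable (body Q \<inter> R T)" if "T \<in> Laver" for T using that by fastforce
      then show ?thesis by blast
    next
      assume "\<exists>S. \<forall>x\<in>body Q. low (g \<xi>) x = S"
      then obtain S where S: "\<And>x. x \<in> body Q \<Longrightarrow> low (g \<xi>) x = S" by blast
      define T0 where "T0 = (SOME T. T \<in> Laver \<and> \<sigma> T = S)"
      have "body Q \<inter> R T = {}" if T: "T \<in> Laver" "T \<noteq> T0" for T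
      proof (rule ccontr)
        assume "body Q \<inter> R T \<noteq> {}"
        then obtain x where x: "x \<in> body Q \<inter> R T" by blast
        have TS: "T \<in> Laver \<and> \<sigma> T = S" using low_Q[OF T(1) x] S x T(1) by blast
        then have "T0 \<in> Laver \<and> \<sigma> T0 = S" unfolding T0_def by (rule someI)
        with TS \<sigma>(2) T(2) show False by (auto dest: inj_onD)
      qed
      then show ?thesis by (intro exI[of _ T0]) simp
    qed
    then show "\<exists>Q\<in>Miller. Q \<subseteq> P \<and> (\<exists>T0. \<forall>T\<in>Laver. T \<noteq> T0 \<longrightarrow> countable (body Q \<inter> R T))"
      using Q Q1(2) by blast
  qed (use Laver_subset_Miller Miller_subset_Sacks splittable_Miller Sacks_body_nonempty in auto)
qed

theorem theorem12:
  shows "(\<exists>B. bernstein Laver B \<and> B \<in> tree_null Miller) \<and>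
         (\<exists>B. bernstein Miller B \<and> B \<in> tree_null Sacks)"
  using Laver_Bernstein_Miller_null Miller_Bernstein_Sacks_null by blast

end
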